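(* Let $n$ be a positive integer. If $\mathcal{S}$ is an $n$-criterion set, then $I_n \in \mathcal{S}$; that is, every $n$-criterion set must include the lattice $I_n$ (lattices being identified up to isometry).
   Context: A lattice means a positive-definite integral $\mathbb{Z}$-lattice: a free $\mathbb{Z}$-module $L$ of finite rank equipped with a positive-definite symmetric bilinear form $B(\cdot,\cdot)$ with $B(L,L)\subseteq\mathbb{Z}$. Equivalently, it is given by a positive-definite symmetric integer Gram matrix (a positive-definite integer-matrix quadratic form). Lattices are considered up to isometry. A lattice $L$ represents a lattice $\ell$ if there exists a $\mathbb{Z}$-linear injection $\ell\to L$ preserving the bilinear forms. A lattice is $n$-universal if it represents all lattices of rank $n$. An $n$-criterion set is a set $\mathcal{S}$ of rank-$n$ lattices having the property that, for every lattice $L$, $L$ is $n$-universal if and only if $L$ represents every lattice in $\mathcal{S}$. $I_n$ denotes the rank-$n$ lattice $\langle 1,\ldots,1\rangle$, i.e. $\mathbb{Z}^n$ with Gram matrix the identity matrix. *)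

theory Defs
  imports "Jordan_Normal_Form.Matrix"
begin

(* A lattice of rank m is given by its Gram matrix G with respect to a Z-basis; the underlying
   module is Z^m = carrier_vec m, so that lattices of all ranks live in the one type int mat.
   Isometric lattices may have different Gram matrices, so membership "up to isometry" in a
   family of lattices is always expressed with isometric_lattices below. *)

definition bilin :: "int mat \<Rightarrow> int vec \<Rightarrow> int vec \<Rightarrow> int" where
  "bilin G x y = x \<bullet> (G *\<^sub>v y)"

definition is_lattice :: "nat \<Rightarrow> int mat \<Rightarrow> bool" where
  "is_lattice m G \<longleftrightarrow>
     G \<in> carrier_mat m m \<and>
     (\<forall>x \<in> carrier_vec m. \<forall>y \<in> carrier_vec m. bilin G x y = bilin G y x) \<and>
     (\<forall>x \<in> carrier_vec m. x \<noteq> 0\<^sub>v m \<longrightarrow> bilin G x x > 0)"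

definition Z_linear :: "nat \<Rightarrow> nat \<Rightarrow> (int vec \<Rightarrow> int vec) \<Rightarrow> bool" where
  "Z_linear m k f \<longleftrightarrow>
     f \<in> carrier_vec m \<rightarrow> carrier_vec k \<and>
     (\<forall>x \<in> carrier_vec m. \<forall>y \<in> carrier_vec m. f (x + y) = f x + f y) \<and>
     (\<forall>a. \<forall>x \<in> carrier_vec m. f (a \<cdot>\<^sub>v x) = a \<cdot>\<^sub>v f x)"

definition preserves_form :: "int mat \<Rightarrow> int mat \<Rightarrow> (int vec \<Rightarrow> int vec) \<Rightarrow> bool" where
  "preserves_form G H f \<longleftrightarrow>
     (\<forall>x \<in> carrier_vec (dim_row G). \<forall>y \<in> carrier_vec (dim_row G).
        bilin H (f x) (f y) = bilin G x y)"

definition represents :: "int mat \<Rightarrow> int mat \<Rightarrow> bool" where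
  "represents L l \<longleftrightarrow>
     (\<exists>f. Z_linear (dim_row l) (dim_row L) f \<and>
          inj_on f (carrier_vec (dim_row l)) \<and>
          preserves_form l L f)"

definition isometric_lattices :: "int mat \<Rightarrow> int mat \<Rightarrow> bool" where
  "isometric_lattices L M \<longleftrightarrow>
     (\<exists>f. Z_linear (dim_row L) (dim_row M) f \<and>
          bij_betw f (carrier_vec (dim_row L)) (carrier_vec (dim_row M)) \<and>
          preserves_form L M f)"

definition n_universal :: "nat \<Rightarrow> int mat \<Rightarrow> bool" where
  "n_universal n L \<longleftrightarrow> (\<forall>l. is_lattice n l \<longrightarrow> represents L l)"

definition n_criterion_set :: "nat \<Rightarrow> int mat set \<Rightarrow> bool" where
  "n_criterion_set n S \<longleftrightarrow>
     (\<forall>l \<in> S. is_lattice n l) \<and>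
     (\<forall>m L. is_lattice m L \<longrightarrow> (n_universal n L \<longleftrightarrow> (\<forall>l \<in> S. represents L l)))"

end

theory Submission
  imports Defs "HOL-Computational_Algebra.Primes" "Jordan_Normal_Form.Determinant"
begin

text \<open>Suppose that no member of the criterion set is isometric to \<open>I\<^sub>n\<close>. A lattice that represents every
lattice of rank \<open>n\<close> except those isometric to \<open>I\<^sub>n\<close> then represents the whole set, so it is
\<open>n\<close>-universal and represents \<open>I\<^sub>n\<close> after all: a contradiction. The work is to construct such a
lattice. It is the orthogonal sum of \<open>I\<close> of rank \<open>n - 1\<close> and a lattice \<open>M\<close> that has no vector of
norm \<open>1\<close> and represents every lattice of rank \<open>n\<close> without vectors of norm \<open>1\<close>
(\<open>norm1_free_universal\<close>).

The sum does not represent \<open>I\<^sub>n\<close> (\<open>not_represents_identity\<close>): its vectors of norm \<open>1\<close> all lie in the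
first summand, whose rank is too small for \<open>n\<close> orthonormal vectors. Now let \<open>l\<close> have rank \<open>n\<close>, and
let \<open>e\<^sub>1, \<dots>, e\<^sub>k\<close> be an orthonormal system in \<open>l\<close> that cannot be enlarged. If \<open>k = n\<close>, then \<open>l\<close> is
isometric to \<open>I\<^sub>n\<close>. Otherwise the first summand takes the coordinates \<open>B(x, e\<^sub>i)\<close>, and \<open>M\<close> takes the
component of \<open>x\<close> orthogonal to the \<open>e\<^sub>i\<close>. To stay in rank \<open>n\<close>, the orthogonal complement is embedded
in the lattice with form \<open>B(x,x) + \<Sum> B(x,e\<^sub>i)\<^sup>2\<close> on the same module, in which the \<open>e\<^sub>i\<close> have norm \<open>2\<close>
and no vector has norm \<open>1\<close> (\<open>represents_without_orthonormal_basis\<close>).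

The existence of \<open>M\<close> is a finiteness statement. For a given \<open>n\<close> there is a fixed \<open>D > 0\<close> such that every
lattice \<open>L\<close> of rank \<open>n\<close> contains nearly orthogonal vectors \<open>c\<^sub>i\<close> whose span contains \<open>D L\<close>
(\<open>exists_nearly_orthogonal\<close>). In the coordinates \<open>a\<^sub>i\<close> given by \<open>D x = \<Sum> a\<^sub>i c\<^sub>i\<close>, the form \<open>D\<^sup>2 B(x,x)\<close>
is diagonally dominant, hence a combination of the squares \<open>a\<^sub>i\<^sup>2\<close> and \<open>(a\<^sub>i \<plusminus> a\<^sub>j)\<^sup>2\<close> with
nonnegative integer weights (\<open>sum_of_weighted_squares\<close>). So \<open>L\<close> is determined up to isometry by
the weights and by the set of all coordinate vectors \<open>a\<close>, which is a union of residue classes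
modulo \<open>D\<close>, so that there are only finitely many possibilities for it. If two lattices \<open>L\<^sub>0, L\<close> have
the same set of coordinate vectors, and if the weights of \<open>L\<close> exceed those of \<open>L\<^sub>0\<close> by nonnegative
multiples of \<open>2 D\<^sup>2\<close>, then the form of \<open>L\<close> is the form of \<open>L\<^sub>0\<close> plus a sum of terms
\<open>2 m \<phi>(x)\<^sup>2\<close> with integral linear forms \<open>\<phi>\<close>; by Lagrange's theorem \<open>L\<close> is represented by the
orthogonal sum of \<open>L\<^sub>0\<close> and \<open>\<langle>2, \<dots>, 2\<rangle>\<close> of a fixed rank (\<open>represents_of_dominated_weights\<close>).
By Dickson's lemma, finitely many lattices \<open>L\<^sub>0\<close>, taken from the given family, serve for
all \<open>L\<close> in it (\<open>finite_basis_of_lattices\<close>). For the family of lattices without vectors of norm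
\<open>1\<close>, let \<open>M\<close> be the orthogonal sum of these \<open>L\<^sub>0\<close> and \<open>\<langle>2, \<dots>, 2\<rangle>\<close>.\<close>

section \<open>Lagrange's theorem on four squares\<close>

lemma nearest_multiple:
  fixes a g :: int
  assumes "g > 0"
  shows "\<exists>t. 2 * \<bar>a - t * g\<bar> \<le> g"
proof -
  define t where "t = (2 * a + g) div (2 * g)"
  have "2 * a + g = t * (2 * g) + (2 * a + g) mod (2 * g)"
    unfolding t_def by (simp only: div_mult_mod_eq)
  moreover have "0 \<le> (2 * a + g) mod (2 * g)" "(2 * a + g) mod (2 * g) < 2 * g"
    using assms by simp_all
  ultimately have "- g \<le> 2 * (a - t * g)" "2 * (a - t * g) \<le> g"
    by (simp_all add: algebra_simps)
  then show ?thesis by (intro exI[of _ t]) linarith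
qed

definition four_squares :: "int \<Rightarrow> bool" where
  "four_squares m \<longleftrightarrow> (\<exists>a b c d. m = a\<^sup>2 + b\<^sup>2 + c\<^sup>2 + d\<^sup>2)"

lemma euler_four_square:
  fixes a b c d e f g h :: int
  shows "(a\<^sup>2 + b\<^sup>2 + c\<^sup>2 + d\<^sup>2) * (e\<^sup>2 + f\<^sup>2 + g\<^sup>2 + h\<^sup>2) =
    (a*e + b*f + c*g + d*h)\<^sup>2 + (a*f - b*e + c*h - d*g)\<^sup>2 +
    (a*g - b*h - c*e + d*f)\<^sup>2 + (a*h + b*g - c*f - d*e)\<^sup>2"
  unfolding power2_eq_square
  by (simp only: ring_distribs mult.commute mult.left_commute mult.assoc)

lemma four_squares_mult:
  assumes "four_squares m" "four_squares k"
  shows "four_squares (m * k)"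
proof -
  obtain a b c d e f g h where "m = a\<^sup>2 + b\<^sup>2 + c\<^sup>2 + d\<^sup>2" "k = e\<^sup>2 + f\<^sup>2 + g\<^sup>2 + h\<^sup>2"
    using assms unfolding four_squares_def by blast
  then show ?thesis unfolding four_squares_def using euler_four_square by blast
qed

text \<open>Fermat descent. Let \<open>m p = a\<^sup>2 + b\<^sup>2 + c\<^sup>2 + d\<^sup>2\<close>, and reduce the four numbers modulo \<open>m\<close> to absolutely least
residues. The residues have a sum of squares \<open>m r\<close> with \<open>r \<le> m\<close>, and Euler's identity writes
\<open>m p \<cdot> m r\<close> as a sum of four squares of multiples of \<open>m\<close>. The extreme cases \<open>r = 0\<close> and \<open>r = m\<close>
would make \<open>m\<^sup>2\<close> divide \<open>m p\<close>, which is impossible for \<open>1 < m < p\<close>.\<close>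

lemma four_squares_descent:
  fixes m p :: int
  assumes p: "prime p" and m: "1 < m" "m < p" and mp: "four_squares (m * p)"
  shows "\<exists>r. 0 < r \<and> r < m \<and> four_squares (r * p)"
proof -
  have not_dvd: "\<not> m dvd p"
  proof
    assume "m dvd p"
    moreover have "0 \<le> m" using m(1) by simp
    ultimately have "m = 1 \<or> m = p" using p unfolding prime_int_iff by blast
    then show False using m by simp
  qed
  obtain a b c d where abcd: "m * p = a\<^sup>2 + b\<^sup>2 + c\<^sup>2 + d\<^sup>2"
    using mp unfolding four_squares_def by blast
  have "\<exists>t. 2 * \<bar>x - t * m\<bar> \<le> m" for x using nearest_multiple m(1) by simp
  then obtain t where t: "\<And>x. 2 * \<bar>x - t x * m\<bar> \<le> m" by metis
  define s where "s x = x - t x * m" for x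
  have x_eq: "x = s x + t x * m" for x by (simp add: s_def)
  have s_le: "2 * \<bar>s x\<bar> \<le> m" for x using t by (simp add: s_def)
  have sq_le: "4 * (s x)\<^sup>2 \<le> m\<^sup>2" for x
  proof -
    have "(2 * \<bar>s x\<bar>)\<^sup>2 \<le> m\<^sup>2" using s_le by (intro power_mono) auto
    then show ?thesis by (simp add: power_mult_distrib)
  qed
  have m_sq: "m dvd x\<^sup>2 - (s x)\<^sup>2" for x
  proof -
    have "x\<^sup>2 - (s x)\<^sup>2 = m * (t x * (x + s x))"
      by (simp add: s_def power2_eq_square algebra_simps)
    then show ?thesis by simp
  qed
  have "m dvd m * p - ((a\<^sup>2 - (s a)\<^sup>2) + (b\<^sup>2 - (s b)\<^sup>2) + (c\<^sup>2 - (s c)\<^sup>2) + (d\<^sup>2 - (s d)\<^sup>2))"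
    by (intro dvd_diff dvd_add m_sq) simp
  then have "m dvd (s a)\<^sup>2 + (s b)\<^sup>2 + (s c)\<^sup>2 + (s d)\<^sup>2"
    unfolding abcd by (simp add: algebra_simps)
  then obtain r where r: "(s a)\<^sup>2 + (s b)\<^sup>2 + (s c)\<^sup>2 + (s d)\<^sup>2 = m * r" by blast
  have "m * r \<ge> 0" unfolding r[symmetric] by simp
  then have r0: "r \<ge> 0" using m(1) by (simp add: zero_le_mult_iff)
  have "4 * (m * r) \<le> 4 * m\<^sup>2"
    unfolding r[symmetric] using sq_le[of a] sq_le[of b] sq_le[of c] sq_le[of d] by simp
  then have "m * r \<le> m * m" by (simp add: power2_eq_square)
  then have rm: "r \<le> m" using m(1) by simp
  have "r \<noteq> 0"
  proof
    assume "r = 0"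
    then have "(s a)\<^sup>2 + (s b)\<^sup>2 + (s c)\<^sup>2 + (s d)\<^sup>2 = 0" using r by simp
    then have z: "s a = 0" "s b = 0" "s c = 0" "s d = 0"
      using zero_le_power2[of "s a"] zero_le_power2[of "s b"] zero_le_power2[of "s c"] zero_le_power2[of "s d"]
      by (simp_all add: add_nonneg_eq_0_iff)
    have sq: "x\<^sup>2 = m * (m * (t x)\<^sup>2)" if "s x = 0" for x
    proof -
      have "x = t x * m" using that x_eq[of x] by simp
      then have "x\<^sup>2 = (t x * m)\<^sup>2" by (rule arg_cong)
      then show ?thesis by (simp add: power2_eq_square algebra_simps)
    qed
    have "m * p = m * (m * ((t a)\<^sup>2 + (t b)\<^sup>2 + (t c)\<^sup>2 + (t d)\<^sup>2))"
      unfolding abcd by (simp add: sq z distrib_left)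
    then have "p = m * ((t a)\<^sup>2 + (t b)\<^sup>2 + (t c)\<^sup>2 + (t d)\<^sup>2)" using m(1) by simp
    then show False using not_dvd by simp
  qed
  moreover have "r \<noteq> m"
  proof
    assume "r = m"
    then have "(s a)\<^sup>2 + (s b)\<^sup>2 + (s c)\<^sup>2 + (s d)\<^sup>2 = m\<^sup>2" using r by (simp add: power2_eq_square)
    then have sq: "4 * (s a)\<^sup>2 = m\<^sup>2" "4 * (s b)\<^sup>2 = m\<^sup>2" "4 * (s c)\<^sup>2 = m\<^sup>2" "4 * (s d)\<^sup>2 = m\<^sup>2"
      using sq_le[of a] sq_le[of b] sq_le[of c] sq_le[of d] by linarith+
    have half: "\<exists>k. 4 * x\<^sup>2 = m\<^sup>2 + 4 * (k * m\<^sup>2)" if "4 * (s x)\<^sup>2 = m\<^sup>2" for x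
    proof -
      have "(2 * s x)\<^sup>2 = m\<^sup>2" using that by (simp only: power_mult_distrib) simp
      then have "2 * s x = m \<or> 2 * s x = - m" by (simp only: power2_eq_iff)
      then have "2 * x = m + 2 * (t x * m) \<or> 2 * x = - m + 2 * (t x * m)"
        using x_eq[of x] by linarith
      then have "(2 * x)\<^sup>2 = m\<^sup>2 + 4 * ((t x + (t x)\<^sup>2) * m\<^sup>2) \<or> (2 * x)\<^sup>2 = m\<^sup>2 + 4 * (((t x)\<^sup>2 - t x) * m\<^sup>2)"
        by (elim disjE; hypsubst_thin?; simp only: power2_eq_square; simp add: algebra_simps)
      moreover have "(2 * x)\<^sup>2 = 4 * x\<^sup>2" by (simp add: power_mult_distrib)
      ultimately show ?thesis by auto
    qed
    obtain ka kb kc kd where "4 * a\<^sup>2 = m\<^sup>2 + 4 * (ka * m\<^sup>2)" "4 * b\<^sup>2 = m\<^sup>2 + 4 * (kb * m\<^sup>2)"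
      "4 * c\<^sup>2 = m\<^sup>2 + 4 * (kc * m\<^sup>2)" "4 * d\<^sup>2 = m\<^sup>2 + 4 * (kd * m\<^sup>2)"
      using half sq by metis
    then have "m * p = m\<^sup>2 + ka * m\<^sup>2 + kb * m\<^sup>2 + kc * m\<^sup>2 + kd * m\<^sup>2"
      unfolding abcd by linarith
    then have "m * p = m * (m * (1 + ka + kb + kc + kd))"
      by (simp add: power2_eq_square algebra_simps)
    then have "p = m * (1 + ka + kb + kc + kd)" using m(1) by simp
    then show False using not_dvd by simp
  qed
  ultimately have r_range: "0 < r" "r < m" using r0 rm by auto
  define z1 where "z1 = p - (a * t a + b * t b + c * t c + d * t d)"
  define z2 where "z2 = - a * t b + b * t a - c * t d + d * t c"
  define z3 where "z3 = - a * t c + b * t d + c * t a - d * t b"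
  define z4 where "z4 = - a * t d - b * t c + c * t b + d * t a"
  have e1: "a * s a + b * s b + c * s c + d * s d = m * z1"
  proof -
    have "m * z1 = (a\<^sup>2 + b\<^sup>2 + c\<^sup>2 + d\<^sup>2) - m * (a * t a + b * t b + c * t c + d * t d)"
      unfolding abcd[symmetric] z1_def by (simp add: algebra_simps)
    then show ?thesis by (simp add: s_def power2_eq_square algebra_simps)
  qed
  have e2: "a * s b - b * s a + c * s d - d * s c = m * z2"
    and e3: "a * s c - b * s d - c * s a + d * s b = m * z3"
    and e4: "a * s d + b * s c - c * s b - d * s a = m * z4"
    by (simp_all add: s_def z2_def z3_def z4_def algebra_simps)
  have "(m * p) * (m * r) = (m * z1)\<^sup>2 + (m * z2)\<^sup>2 + (m * z3)\<^sup>2 + (m * z4)\<^sup>2"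
    unfolding abcd r[symmetric] euler_four_square e1 e2 e3 e4 ..
  then have "m\<^sup>2 * (r * p) = m\<^sup>2 * (z1\<^sup>2 + z2\<^sup>2 + z3\<^sup>2 + z4\<^sup>2)"
    by (simp add: power2_eq_square algebra_simps)
  then have "r * p = z1\<^sup>2 + z2\<^sup>2 + z3\<^sup>2 + z4\<^sup>2" using m(1) by simp
  then show ?thesis using r_range unfolding four_squares_def by blast
qed

text \<open>Pigeonhole principle: \<open>x\<^sup>2\<close> and \<open>- 1 - y\<^sup>2\<close> each take \<open>(p + 1) div 2\<close> residues modulo \<open>p\<close>, so they have one in
common. The bounds on \<open>x\<close> and \<open>y\<close> give the descent a starting multiple below \<open>p\<^sup>2\<close>.\<close>

lemma prime_dvd_sum_two_squares_plus_one:
  fixes p :: int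
  assumes p: "prime p" and odd: "odd p"
  shows "\<exists>x y. 0 \<le> x \<and> 2 * x < p \<and> 0 \<le> y \<and> 2 * y < p \<and> p dvd x\<^sup>2 + y\<^sup>2 + 1"
proof -
  obtain h where h: "p = 2 * h + 1" using odd by (elim oddE)
  have "p > 1" using p prime_gt_1_int by blast
  then have h0: "h \<ge> 0" using h by simp
  have inj: "x = y" if "x \<in> {0..h}" "y \<in> {0..h}" "p dvd x\<^sup>2 - y\<^sup>2" for x y
  proof -
    have "p dvd (x - y) * (x + y)" using that(3) by (simp add: power2_eq_square algebra_simps)
    then have "p dvd x - y \<or> p dvd x + y" using p by (simp add: prime_dvd_mult_iff)
    then show ?thesis
    proof
      assume "p dvd x - y"
      moreover have "\<bar>x - y\<bar> < p" using that(1,2) h by auto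
      ultimately have "x - y = 0" using dvd_imp_le_int[of "x - y" p] \<open>1 < p\<close> by (cases "x - y = 0") auto
      then show ?thesis by simp
    next
      assume "p dvd x + y"
      moreover have "0 \<le> x + y" "x + y < p" using that(1,2) h by auto
      ultimately have "x + y = 0" using zdvd_not_zless[of "x + y" p] by (cases "x + y = 0") auto
      then show ?thesis using that(1,2) by auto
    qed
  qed
  define A where "A = (\<lambda>x. x\<^sup>2 mod p) ` {0..h}"
  define B where "B = (\<lambda>y. (- 1 - y\<^sup>2) mod p) ` {0..h}"
  have "inj_on (\<lambda>x. x\<^sup>2 mod p) {0..h}"
    by (intro inj_onI inj) (auto simp: mod_eq_dvd_iff)
  then have cA: "card A = nat (h + 1)" unfolding A_def by (simp add: card_image)
  have "inj_on (\<lambda>y. (- 1 - y\<^sup>2) mod p) {0..h}"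
  proof (intro inj_onI)
    fix x y assume xy: "x \<in> {0..h}" "y \<in> {0..h}" and "(- 1 - x\<^sup>2) mod p = (- 1 - y\<^sup>2) mod p"
    then have "p dvd y\<^sup>2 - x\<^sup>2" by (simp add: mod_eq_dvd_iff)
    then show "x = y" using inj[of y x] xy by simp
  qed
  then have cB: "card B = nat (h + 1)" unfolding B_def by (simp add: card_image)
  have sub: "A \<union> B \<subseteq> {0..<p}" using \<open>p > 1\<close> by (auto simp: A_def B_def)
  have "A \<inter> B \<noteq> {}"
  proof
    assume "A \<inter> B = {}"
    then have "card (A \<union> B) = nat (h + 1) + nat (h + 1)"
      using cA cB by (simp add: card_Un_disjoint A_def B_def)
    moreover have "card (A \<union> B) \<le> card {0..<p}" using sub by (intro card_mono) auto
    ultimately show False using h h0 by simp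
  qed
  then obtain x y where xy: "x \<in> {0..h}" "y \<in> {0..h}" "x\<^sup>2 mod p = (- 1 - y\<^sup>2) mod p"
    unfolding A_def B_def by blast
  then have "p dvd x\<^sup>2 + y\<^sup>2 + 1" by (simp add: mod_eq_dvd_iff algebra_simps)
  then show ?thesis using xy(1,2) h by (intro exI[of _ x] exI[of _ y]) auto
qed

lemma four_squares_prime:
  fixes p :: int
  assumes p: "prime p"
  shows "four_squares p"
proof (cases "odd p")
  case False
  then have "p = 2" using p by (metis primes_dvd_imp_eq two_is_prime_nat prime_int_numeral_eq)
  then have "p = 1\<^sup>2 + 1\<^sup>2 + 0\<^sup>2 + 0\<^sup>2" by simp
  then show ?thesis unfolding four_squares_def by blast
next
  case True
  have p1: "p > 1" using p prime_gt_1_int by blast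
  obtain x y where xy: "0 \<le> x" "2 * x < p" "0 \<le> y" "2 * y < p" "p dvd x\<^sup>2 + y\<^sup>2 + 1"
    using prime_dvd_sum_two_squares_plus_one[OF p True] by blast
  obtain k where k: "x\<^sup>2 + y\<^sup>2 + 1 = k * p" using xy(5) by (metis dvdE mult.commute)
  have "four_squares (k * p)"
    unfolding four_squares_def k[symmetric] by (rule exI[of _ x], rule exI[of _ y], rule exI[of _ 1], rule exI[of _ 0]) simp
  moreover have "0 < k * p" unfolding k[symmetric] using zero_le_power2[of x] zero_le_power2[of y] by linarith
  then have "0 < k" using p1 by (simp add: zero_less_mult_iff)
  moreover have "k < p"
  proof -
    have "(2 * x)\<^sup>2 \<le> (p - 1)\<^sup>2" "(2 * y)\<^sup>2 \<le> (p - 1)\<^sup>2"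
      by (rule power_mono; use xy p1 in simp)+
    then have "4 * (k * p) \<le> 2 * (p - 1)\<^sup>2 + 4" unfolding k[symmetric] by (simp add: power_mult_distrib)
    also have "\<dots> < 4 * (p * p)"
    proof -
      have "2 * (p - 1)\<^sup>2 + 4 = 2 * (p * p) - 4 * p + 6" by (simp add: power2_eq_square algebra_simps)
      moreover have "p * p \<ge> 2 * 2" using p1 by (intro mult_mono) auto
      ultimately show ?thesis using p1 by linarith
    qed
    finally have "k * p < p * p" by simp
    then show ?thesis using p1 by simp
  qed
  ultimately have ex: "\<exists>m::nat. 0 < m \<and> int m < p \<and> four_squares (int m * p)"
    by (intro exI[of _ "nat k"]) auto
  define m where "m = (LEAST m::nat. 0 < m \<and> int m < p \<and> four_squares (int m * p))"
  have m: "0 < m" "int m < p" "four_squares (int m * p)"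
    using LeastI_ex[OF ex] unfolding m_def by auto
  have least: "\<not> (0 < j \<and> int j < p \<and> four_squares (int j * p))" if "j < m" for j
    using not_less_Least that unfolding m_def by blast
  have "m = 1"
  proof (rule ccontr)
    assume "m \<noteq> 1"
    then obtain r where r: "0 < r" "r < int m" "four_squares (r * p)"
      using four_squares_descent[OF p, of "int m"] m by auto
    then show False using least[of "nat r"] m(2) by (simp add: nat_less_iff)
  qed
  then show ?thesis using m(3) by simp
qed

theorem lagrange_four_squares:
  fixes m :: int
  assumes "m \<ge> 0"
  shows "\<exists>a b c d. m = a\<^sup>2 + b\<^sup>2 + c\<^sup>2 + d\<^sup>2"
proof -
  have "four_squares (int k)" for k
  proof (induction k rule: less_induct)
    case (less k)
    show ?case
    proof (cases "k \<le> 1")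
      case True
      then have "int k = (int k)\<^sup>2 + 0\<^sup>2 + 0\<^sup>2 + 0\<^sup>2" by (cases k) auto
      then show ?thesis unfolding four_squares_def by blast
    next
      case False
      then obtain p where p: "prime p" "p dvd k" using prime_factor_nat[of k] by auto
      then obtain j where j: "k = p * j" by blast
      have "j < k" using j False prime_gt_1_nat[OF p(1)] by (cases "j = 0") auto
      then have "four_squares (int p * int j)"
        by (intro four_squares_mult four_squares_prime less) (use p(1) in auto)
      then show ?thesis using j by simp
    qed
  qed
  from this[of "nat m"] show ?thesis using assms unfolding four_squares_def by simp
qed

section \<open>Positive semidefinite integral forms\<close>

text \<open>A lattice of rank \<open>n\<close> is treated as a form on all functions \<open>nat \<Rightarrow> int\<close> that depends only on the first
\<open>n\<close> values; the other values lie in the radical. Semidefiniteness is also preserved by projection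
along a vector, so that no basis of a quotient module has to be chosen.\<close>

locale psd_form =
  fixes B :: "(nat \<Rightarrow> int) \<Rightarrow> (nat \<Rightarrow> int) \<Rightarrow> int"
  assumes linear: "B (\<lambda>k. a * x k + b * y k) z = a * B x z + b * B y z"
    and symmetric: "B x y = B y x"
    and nonneg: "B x x \<ge> 0"
begin

lemma linear_right: "B z (\<lambda>k. a * x k + b * y k) = a * B z x + b * B z y"
  using linear symmetric by metis

lemma scale_left: "B (\<lambda>k. a * x k) z = a * B x z"
  using linear[of a x 0 x z] by simp

lemma scale_right: "B z (\<lambda>k. a * x k) = a * B z x"
  using scale_left symmetric by metis

lemma diff_left: "B (\<lambda>k. x k - y k) z = B x z - B y z"
  using linear[of 1 x "-1" y z] by simp

lemma diff_right: "B z (\<lambda>k. x k - y k) = B z x - B z y"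
  using diff_left symmetric by metis

lemma quad_diff: "B (\<lambda>k. x k - y k) (\<lambda>k. x k - y k) = B x x - 2 * B x y + B y y"
  using symmetric[of y x] by (simp add: diff_left diff_right)

lemma sum_left:
  fixes r :: nat
  shows "B (\<lambda>k. \<Sum>i<r. a i * v i k) z = (\<Sum>i<r. a i * B (v i) z)"
proof (induction r)
  case 0
  then show ?case using scale_left[of 0 "\<lambda>_. 0" z] by simp
next
  case (Suc r)
  have "B (\<lambda>k. 1 * (\<Sum>i<r. a i * v i k) + a r * v r k) z =
      1 * B (\<lambda>k. \<Sum>i<r. a i * v i k) z + a r * B (v r) z"
    by (rule linear)
  then show ?case using Suc by simp
qed

lemma sum_right: "B z (\<lambda>k. \<Sum>i<(r::nat). a i * v i k) = (\<Sum>i<r. a i * B z (v i))"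
  using sum_left[where r = r and a = a and v = v and z = z] symmetric by simp

text \<open>For \<open>B y y = 0\<close>, testing \<open>x - t y\<close> with a \<open>t\<close> that is large in the direction of \<open>B x y\<close> forces \<open>B x y = 0\<close>;
otherwise the norm of \<open>B y y \<cdot> x - B x y \<cdot> y\<close> gives the inequality up to the factor \<open>B y y\<close>.\<close>

lemma cauchy_schwarz: "(B x y)\<^sup>2 \<le> B x x * B y y"
proof (cases "B y y = 0")
  case True
  let ?t = "B x y * (B x x + 1)"
  have "B (\<lambda>k. x k - ?t * y k) (\<lambda>k. x k - ?t * y k) = B x x - 2 * ((B x y)\<^sup>2 * (B x x + 1))"
    by (simp add: quad_diff scale_left scale_right True power2_eq_square; simp add: algebra_simps)
  then have le: "2 * ((B x y)\<^sup>2 * (B x x + 1)) \<le> B x x"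
    using nonneg by (metis diff_ge_0_iff_ge)
  have "B x y = 0"
  proof (rule ccontr)
    assume "B x y \<noteq> 0"
    then have "1 \<le> (B x y)\<^sup>2" by (simp add: int_one_le_iff_zero_less)
    then have "B x x + 1 \<le> (B x y)\<^sup>2 * (B x x + 1)"
      using nonneg[of x] mult_right_mono[of 1 "(B x y)\<^sup>2" "B x x + 1"] by auto
    then have "2 * (B x x + 1) \<le> B x x" using le by (meson mult_left_mono order_trans zero_le_numeral)
    then show False using nonneg[of x] by simp
  qed
  then show ?thesis by (simp add: True)
next
  case False
  then have pos: "B y y > 0" using nonneg[of y] by simp
  let ?z = "\<lambda>k. B y y * x k - B x y * y k"
  have "B ?z ?z = B y y * (B x x * B y y - (B x y)\<^sup>2)"
    by (simp add: quad_diff scale_left scale_right power2_eq_square; simp add: algebra_simps)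
  then have "0 \<le> B y y * (B x x * B y y - (B x y)\<^sup>2)" using nonneg by metis
  then show ?thesis using pos by (simp add: zero_le_mult_iff)
qed

text \<open>The rank of the quotient by the radical is at most \<open>r\<close>: any \<open>r + 1\<close> vectors satisfy a nontrivial
integral relation modulo the radical.\<close>

definition rank_le :: "nat \<Rightarrow> bool" where
  "rank_le r \<longleftrightarrow> (\<forall>v. \<exists>a. (\<exists>i<Suc r. a i \<noteq> 0) \<and>
     B (\<lambda>k. \<Sum>i<Suc r. a i * v i k) (\<lambda>k. \<Sum>i<Suc r. a i * v i k) = 0)"

text \<open>The form induced on the orthogonal complement of \<open>b\<close>, pulled back along the orthogonal projection
and multiplied by \<open>B b b\<close> so that it stays integral.\<close>

definition proj :: "(nat \<Rightarrow> int) \<Rightarrow> (nat \<Rightarrow> int) \<Rightarrow> (nat \<Rightarrow> int) \<Rightarrow> int" where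
  "proj b x y = B b b * B x y - B b x * B b y"

lemma psd_form_proj: "psd_form (proj b)"
proof
  show "proj b (\<lambda>k. a * x k + c * y k) z = a * proj b x z + c * proj b y z" for a x c y z
    unfolding proj_def linear linear_right by (simp add: algebra_simps)
  show "proj b x y = proj b y x" for x y
    unfolding proj_def using symmetric[of x y] by simp
  show "0 \<le> proj b x x" for x
    unfolding proj_def using cauchy_schwarz[of b x] by (simp add: power2_eq_square)
qed

text \<open>A relation between \<open>b\<close> and \<open>v\<^sub>0, \<dots>, v\<^sub>r\<close> for \<open>B\<close> becomes a relation between the \<open>v\<^sub>i\<close> for the projected form,
which annihilates \<open>b\<close>. It remains nontrivial, because \<open>b\<close> alone is not in the radical of \<open>B\<close>.\<close>

lemma rank_le_proj:
  assumes "rank_le (Suc r)" and pos: "B b b > 0"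
  shows "psd_form.rank_le (proj b) r"
  unfolding psd_form.rank_le_def[OF psd_form_proj]
proof
  fix v :: "nat \<Rightarrow> nat \<Rightarrow> int"
  obtain a where nz: "\<exists>i<Suc (Suc r). a i \<noteq> 0" and
    z: "B (\<lambda>k. \<Sum>i<Suc (Suc r). a i * case_nat b v i k)
          (\<lambda>k. \<Sum>i<Suc (Suc r). a i * case_nat b v i k) = 0"
    using assms(1) unfolding rank_le_def by meson
  let ?w = "\<lambda>k. \<Sum>i<Suc r. a (Suc i) * v i k"
  have eq: "(\<lambda>k. \<Sum>i<Suc (Suc r). a i * case_nat b v i k) = (\<lambda>k. a 0 * b k + 1 * ?w k)"
    by (subst sum.lessThan_Suc_shift) simp
  have q: "a 0 * a 0 * B b b + 2 * a 0 * B b ?w + B ?w ?w = 0"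
    using z unfolding eq linear linear_right symmetric[of ?w b] by (simp only: algebra_simps)
  have "B b b * B ?w ?w = (B b ?w)\<^sup>2 - (a 0 * B b b + B b ?w)\<^sup>2"
    using arg_cong[OF q, of "\<lambda>t. B b b * t"] by (simp add: power2_eq_square algebra_simps)
  then have "B b b * B ?w ?w \<le> (B b ?w)\<^sup>2" by simp
  then have "proj b ?w ?w = 0"
    using cauchy_schwarz[of b ?w] unfolding proj_def by (simp add: power2_eq_square)
  moreover have "\<exists>i<Suc r. a (Suc i) \<noteq> 0"
  proof (rule ccontr)
    assume "\<not> ?thesis"
    then have tail: "\<And>i. i < Suc r \<Longrightarrow> a (Suc i) = 0" by blast
    then have "a 0 \<noteq> 0" using nz by (metis less_Suc_eq_0_disj)
    moreover have "?w = (\<lambda>k. 0 * b k)" using tail by (intro ext) (simp add: sum.neutral)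
    then have "B b ?w = 0" "B ?w ?w = 0" using scale_right[of _ 0 b] by simp_all
    then have "a 0 * a 0 * B b b = 0" using q by simp
    ultimately show False using pos by simp
  qed
  ultimately show "\<exists>a. (\<exists>i<Suc r. a i \<noteq> 0) \<and>
       proj b (\<lambda>k. \<Sum>i<Suc r. a i * v i k) (\<lambda>k. \<Sum>i<Suc r. a i * v i k) = 0"
    by (intro exI[of _ "\<lambda>i. a (Suc i)"]) auto
qed

section \<open>Nearly orthogonal systems of bounded index\<close>

definition nearly_orthogonal :: "int \<Rightarrow> nat \<Rightarrow> (nat \<Rightarrow> nat \<Rightarrow> int) \<Rightarrow> bool" where
  "nearly_orthogonal M s c \<longleftrightarrow> (\<forall>i<s. B (c i) (c i) > 0) \<and>
     (\<forall>i<s. \<forall>j<s. i \<noteq> j \<longrightarrow> M * \<bar>B (c i) (c j)\<bar> \<le> B (c i) (c i))"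

lemma proj_shift: "proj b (\<lambda>k. x k - t * b k) y = proj b x y"
  by (simp add: proj_def diff_left diff_right scale_left scale_right algebra_simps)

text \<open>Hermite's estimate. Every vector can be moved by a multiple of \<open>b\<close> so that \<open>2 \<bar>B b y\<bar> \<le> B b b\<close>. If \<open>b\<close> has
the least positive norm, the moved vector either has norm at least \<open>B b b\<close>, and at most a quarter of
that is lost under projection, or it lies in the radical.\<close>

lemma minimal_vector_projection:
  assumes pos: "B b b > 0" and minimal: "\<And>x. B x x > 0 \<Longrightarrow> B b b \<le> B x x"
  shows "proj b y y > 0 \<Longrightarrow> 3 * (B b b)\<^sup>2 \<le> 4 * proj b y y"
    and "proj b y y = 0 \<Longrightarrow> \<exists>t. B (\<lambda>k. y k - t * b k) (\<lambda>k. y k - t * b k) = 0"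
proof -
  interpret P: psd_form "proj b" by (rule psd_form_proj)
  obtain t where t: "2 * \<bar>B b y - t * B b b\<bar> \<le> B b b"
    using nearest_multiple[OF pos] by blast
  define z where "z = (\<lambda>k. y k - t * b k)"
  have bz: "B b z = B b y - t * B b b" by (simp add: z_def diff_right scale_right)
  have "(2 * \<bar>B b z\<bar>)\<^sup>2 \<le> (B b b)\<^sup>2" using t unfolding bz by (intro power_mono) auto
  then have sq: "4 * (B b z)\<^sup>2 \<le> (B b b)\<^sup>2" by (simp add: power_mult_distrib)
  have "proj b z z = proj b y y"
    unfolding z_def using proj_shift P.symmetric by metis
  then have pz: "B b b * B z z = proj b y y + (B b z)\<^sup>2"
    by (simp add: proj_def power2_eq_square)
  show "3 * (B b b)\<^sup>2 \<le> 4 * proj b y y" if "proj b y y > 0"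
  proof -
    have "B b b * B z z > 0" unfolding pz using that by (simp add: add_pos_nonneg)
    then have "B z z > 0" using pos by (simp add: zero_less_mult_iff)
    then have "B b b * B b b \<le> B b b * B z z" using minimal pos by simp
    then show ?thesis using pz sq by (simp add: power2_eq_square)
  qed
  show "\<exists>t. B (\<lambda>k. y k - t * b k) (\<lambda>k. y k - t * b k) = 0" if "proj b y y = 0"
  proof -
    have "B b b * (4 * B z z) \<le> B b b * B b b"
      using pz sq that by (simp add: power2_eq_square)
    then have "4 * B z z \<le> B b b" using pos by simp
    then have "B z z = 0" using minimal[of z] nonneg[of z] pos by linarith
    then show ?thesis unfolding z_def by blast
  qed
qed

end

text \<open>Bounded index is the point here: \<open>D\<close> depends on \<open>M\<close> and on the rank, not on the form. The proof is by induction on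
the rank. Let \<open>b\<close> be a vector of least positive norm, and let \<open>y\<^sub>i\<close> be a system for the form
projected along \<open>b\<close>, with \<open>2 M\<close> in place of \<open>M\<close>. Take \<open>M b\<close> together with the vectors
\<open>M y\<^sub>i - t\<^sub>i b\<close>, where \<open>t\<^sub>i\<close> makes the inner product with \<open>b\<close> at most half of the norm of \<open>b\<close> in
absolute value. That inner product is small compared with the norms because all vectors were
scaled by \<open>M\<close> and, by Hermite's estimate, the projections of the \<open>y\<^sub>i\<close> are not short. The index
condition passes from \<open>D'\<close> to \<open>M\<^sup>2 D'\<close>.\<close>

lemma exists_nearly_orthogonal:
  fixes M :: int
  assumes "M > 0"
  shows "\<exists>D>0. \<forall>B. psd_form B \<longrightarrow> psd_form.rank_le B r \<longrightarrow>
    (\<exists>s c. s \<le> r \<and> psd_form.nearly_orthogonal B M s c \<and>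
      (\<forall>x. \<exists>a. B (\<lambda>k. D * x k - (\<Sum>i<s. a i * c i k)) (\<lambda>k. D * x k - (\<Sum>i<s. a i * c i k)) = 0))"
  using assms
proof (induction r arbitrary: M)
  case 0
  show ?case
  proof (rule exI[of _ 1], intro conjI allI impI)
    fix B
    assume "psd_form B"
    then interpret psd_form B .
    assume rank: "rank_le 0"
    have zero: "B x x = 0" for x
    proof -
      obtain a where "a (0::nat) \<noteq> (0::int)" "B (\<lambda>k. a 0 * x k) (\<lambda>k. a 0 * x k) = 0"
        using rank[unfolded rank_le_def, rule_format, of "\<lambda>_. x"] by auto
      then show ?thesis by (simp add: scale_left scale_right)
    qed
    show "\<exists>s c. s \<le> 0 \<and> nearly_orthogonal M s c \<and>
      (\<forall>x. \<exists>a. B (\<lambda>k. 1 * x k - (\<Sum>i<s. a i * c i k)) (\<lambda>k. 1 * x k - (\<Sum>i<s. a i * c i k)) = 0)"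
      by (rule exI[of _ 0]) (simp add: nearly_orthogonal_def zero)
  qed simp
next
  case (Suc r)
  obtain D' where D': "D' > 0" and
    IH: "\<And>B. psd_form B \<Longrightarrow> psd_form.rank_le B r \<Longrightarrow>
    \<exists>s c. s \<le> r \<and> psd_form.nearly_orthogonal B (2 * M) s c \<and>
      (\<forall>x. \<exists>a. B (\<lambda>k. D' * x k - (\<Sum>i<s. a i * c i k)) (\<lambda>k. D' * x k - (\<Sum>i<s. a i * c i k)) = 0)"
    using Suc.IH[of "2 * M"] Suc.prems by auto
  show ?case
  proof (rule exI[of _ "M\<^sup>2 * D'"], intro conjI allI impI)
    show "0 < M\<^sup>2 * D'" using Suc.prems D' by simp
    fix B
    assume "psd_form B"
    then interpret psd_form B .
    assume rank: "rank_le (Suc r)"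
    let ?goal = "\<lambda>s c. s \<le> Suc r \<and> nearly_orthogonal M s c \<and> (\<forall>x. \<exists>a.
      B (\<lambda>k. M\<^sup>2 * D' * x k - (\<Sum>i<s. a i * c i k)) (\<lambda>k. M\<^sup>2 * D' * x k - (\<Sum>i<s. a i * c i k)) = 0)"
    show "\<exists>s c. ?goal s c"
    proof (cases "\<forall>x. B x x = 0")
      case True
      then have "?goal 0 undefined" by (simp add: nearly_orthogonal_def)
      then show ?thesis by blast
    next
      case False
      then have "\<exists>x. B x x > 0" using nonneg by (metis order_le_less)
      then have "\<exists>b. B b b > 0 \<and> (\<forall>x. B x x > 0 \<longrightarrow> B b b \<le> B x x)"
        using ex_has_least_nat[of "\<lambda>x. B x x > 0" _ "\<lambda>x. nat (B x x)"] by force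
      then obtain b where pos: "B b b > 0" and minimal: "\<And>x. B x x > 0 \<Longrightarrow> B b b \<le> B x x"
        by blast
      define g where "g = B b b"
      interpret P: psd_form "proj b" by (rule psd_form_proj)
      obtain s y where s: "s \<le> r" and ortho: "P.nearly_orthogonal (2 * M) s y" and
        span: "\<And>x. \<exists>a. proj b (\<lambda>k. D' * x k - (\<Sum>i<s. a i * y i k)) (\<lambda>k. D' * x k - (\<Sum>i<s. a i * y i k)) = 0"
        using IH[OF psd_form_proj rank_le_proj[OF rank pos]] by blast
      have "\<forall>i. \<exists>t. 2 * \<bar>M * B b (y i) - t * g\<bar> \<le> g"
        using nearest_multiple pos by (simp add: g_def)
      then obtain t where t: "\<And>i. 2 * \<bar>M * B b (y i) - t i * g\<bar> \<le> g" by metis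
      \<comment> \<open>lifts of the projected system, nearly orthogonal to \<open>b\<close>\<close>
      define z where "z i = (\<lambda>k. M * y i k - t i * b k)" for i
      have bz: "2 * \<bar>B b (z i)\<bar> \<le> g" for i
        using t[of i] by (simp add: z_def diff_right scale_right g_def)
      have pz: "proj b (z i) (z j) = M\<^sup>2 * proj b (y i) (y j)" for i j
      proof -
        have "proj b (z i) (z j) = proj b (\<lambda>k. M * y i k) (z j)" by (simp add: z_def proj_shift)
        also have "\<dots> = M * proj b (y i) (z j)" by (rule P.scale_left)
        also have "proj b (y i) (z j) = proj b (z j) (y i)" by (rule P.symmetric)
        also have "\<dots> = M * proj b (y j) (y i)" by (simp add: z_def proj_shift P.scale_left)
        finally show ?thesis using P.symmetric[of "y j" "y i"] by (simp add: power2_eq_square)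
      qed
      \<comment> \<open>splits inner products into the projected part and the part along \<open>b\<close>\<close>
      have gz: "g * B (z i) (z j) = M\<^sup>2 * proj b (y i) (y j) + B b (z i) * B b (z j)" for i j
        using pz[of i j] by (simp add: proj_def g_def)
      have py: "proj b (y i) (y i) > 0" "3 * g\<^sup>2 \<le> 4 * proj b (y i) (y i)" if "i < s" for i
      proof -
        show "proj b (y i) (y i) > 0" using ortho that by (simp add: P.nearly_orthogonal_def)
        then show "3 * g\<^sup>2 \<le> 4 * proj b (y i) (y i)"
          using minimal_vector_projection(1)[OF pos minimal] by (simp add: g_def)
      qed
      have gzz: "M\<^sup>2 * proj b (y i) (y i) \<le> g * B (z i) (z i)" for i
        using gz[of i i] by simp
      have zpos: "B (z i) (z i) > 0" if "i < s" for i
      proof -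
        have "0 < M\<^sup>2 * proj b (y i) (y i)" using py(1)[OF that] Suc.prems by simp
        then have "0 < g * B (z i) (z i)" using gzz[of i] by linarith
        then show ?thesis using pos by (simp add: g_def zero_less_mult_iff)
      qed
      have z_large: "3 * M\<^sup>2 * g \<le> 4 * B (z i) (z i)" if "i < s" for i
      proof -
        have "M\<^sup>2 * (3 * g\<^sup>2) \<le> M\<^sup>2 * (4 * proj b (y i) (y i))"
          using py(2)[OF that] by (intro mult_left_mono) auto
        then have "g * (3 * M\<^sup>2 * g) \<le> g * (4 * B (z i) (z i))"
          using gzz[of i] by (simp add: power2_eq_square algebra_simps)
        then show ?thesis using pos by (simp add: g_def)
      qed
      have MM: "M \<le> M\<^sup>2" using Suc.prems self_le_power[of M 2] by simp
      have zz: "M * \<bar>B (z i) (z j)\<bar> \<le> B (z i) (z i)" if ij: "i < s" "j < s" "i \<noteq> j" for i j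
      proof -
        have "(2 * \<bar>B b (z i)\<bar>) * (2 * \<bar>B b (z j)\<bar>) \<le> g * g"
          using bz by (intro mult_mono) (auto simp: g_def pos less_imp_le)
        then have 1: "4 * \<bar>B b (z i) * B b (z j)\<bar> \<le> g\<^sup>2"
          by (simp add: abs_mult power2_eq_square)
        have 2: "2 * M * \<bar>proj b (y i) (y j)\<bar> \<le> proj b (y i) (y i)"
          using ortho ij by (simp add: P.nearly_orthogonal_def)
        have "g * \<bar>B (z i) (z j)\<bar> = \<bar>g * B (z i) (z j)\<bar>"
          using pos by (simp add: abs_mult g_def)
        also have "\<dots> \<le> M\<^sup>2 * \<bar>proj b (y i) (y j)\<bar> + \<bar>B b (z i) * B b (z j)\<bar>"
          unfolding gz using abs_triangle_ineq[of "M\<^sup>2 * proj b (y i) (y j)" "B b (z i) * B b (z j)"]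
          by (simp add: abs_mult)
        finally have "4 * M * (g * \<bar>B (z i) (z j)\<bar>) \<le>
            4 * M * (M\<^sup>2 * \<bar>proj b (y i) (y j)\<bar> + \<bar>B b (z i) * B b (z j)\<bar>)"
          using Suc.prems by (intro mult_left_mono) auto
        also have "\<dots> = 2 * M\<^sup>2 * (2 * M * \<bar>proj b (y i) (y j)\<bar>) + M * (4 * \<bar>B b (z i) * B b (z j)\<bar>)"
          by (simp add: algebra_simps)
        also have "\<dots> \<le> 2 * M\<^sup>2 * proj b (y i) (y i) + M * g\<^sup>2"
          using 1 2 Suc.prems by (intro add_mono mult_left_mono) auto
        also have "M * g\<^sup>2 \<le> M\<^sup>2 * (2 * proj b (y i) (y i))"
        proof (rule mult_mono[OF MM])
          have "0 \<le> g\<^sup>2" by simp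
          then show "g\<^sup>2 \<le> 2 * proj b (y i) (y i)" using py(2)[OF ij(1)] by linarith
        qed auto
        finally have "4 * M * (g * \<bar>B (z i) (z j)\<bar>) \<le> 4 * (M\<^sup>2 * proj b (y i) (y i))"
          by (simp add: algebra_simps)
        then have "g * (M * \<bar>B (z i) (z j)\<bar>) \<le> g * B (z i) (z i)"
          using gzz[of i] by (simp add: algebra_simps)
        then show ?thesis using pos by (simp add: g_def)
      qed
      define c where "c = case_nat (\<lambda>k. M * b k) z"
      have c_simps: "c 0 = (\<lambda>k. M * b k)" "c (Suc i) = z i" for i by (simp_all add: c_def)
      have "nearly_orthogonal M (Suc s) c"
      proof -
        have c00: "B (c 0) (c 0) = M * (M * g)" by (simp add: c_simps scale_left scale_right g_def)
        have c0z: "B (c 0) (z i) = M * B b (z i)" "B (z i) (c 0) = M * B b (z i)" for i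
          using symmetric[of "z i" b] by (simp_all add: c_simps scale_left scale_right)
        have z0: "2 * (M * \<bar>M * B b (z i)\<bar>) \<le> M\<^sup>2 * g" for i
        proof -
          have "2 * (M * \<bar>M * B b (z i)\<bar>) = M\<^sup>2 * (2 * \<bar>B b (z i)\<bar>)"
            using Suc.prems by (simp add: abs_mult power2_eq_square)
          also have "\<dots> \<le> M\<^sup>2 * g" using bz by (intro mult_left_mono) auto
          finally show ?thesis .
        qed
        have g0: "0 < M\<^sup>2 * g" using pos Suc.prems by (simp add: g_def)
        have "M * \<bar>B (c 0) (z i)\<bar> \<le> B (c 0) (c 0)" for i
          unfolding c0z c00 using z0[of i] g0 by (simp add: power2_eq_square)
        moreover have "M * \<bar>B (z i) (c 0)\<bar> \<le> B (z i) (z i)" if "i < s" for i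
          unfolding c0z using z0[of i] z_large[OF that] g0 by linarith
        moreover have "B (c 0) (c 0) > 0" unfolding c00 using g0 by (simp add: power2_eq_square)
        ultimately show ?thesis
          unfolding nearly_orthogonal_def using zz zpos
          by (auto simp: less_Suc_eq_0_disj c_simps(2)) (metis zz)
      qed
      moreover have "\<exists>a. B (\<lambda>k. M\<^sup>2 * D' * x k - (\<Sum>i<Suc s. a i * c i k))
          (\<lambda>k. M\<^sup>2 * D' * x k - (\<Sum>i<Suc s. a i * c i k)) = 0" for x
      proof -
        obtain a where "proj b (\<lambda>k. D' * x k - (\<Sum>i<s. a i * y i k)) (\<lambda>k. D' * x k - (\<Sum>i<s. a i * y i k)) = 0"
          using span by blast
        then obtain u where u: "B (\<lambda>k. (D' * x k - (\<Sum>i<s. a i * y i k)) - u * b k)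
            (\<lambda>k. (D' * x k - (\<Sum>i<s. a i * y i k)) - u * b k) = 0" (is "B ?w ?w = 0")
          using minimal_vector_projection(2)[OF pos minimal] by blast
        define a' where "a' = case_nat (M * u + (\<Sum>i<s. a i * t i)) (\<lambda>i. M * a i)"
        have "(\<lambda>k. M\<^sup>2 * D' * x k - (\<Sum>i<Suc s. a' i * c i k)) = (\<lambda>k. M\<^sup>2 * ?w k)"
        proof
          fix k
          have "(\<Sum>i<Suc s. a' i * c i k) =
              (M * u + (\<Sum>i<s. a i * t i)) * (M * b k) + (\<Sum>i<s. M * a i * (M * y i k - t i * b k))"
            by (subst sum.lessThan_Suc_shift) (simp add: a'_def c_simps z_def)
          also have "(\<Sum>i<s. M * a i * (M * y i k - t i * b k)) =
              M\<^sup>2 * (\<Sum>i<s. a i * y i k) - (\<Sum>i<s. a i * t i) * (M * b k)"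
            by (simp add: sum_distrib_left sum_distrib_right sum_subtractf[symmetric] power2_eq_square algebra_simps)
          finally show "M\<^sup>2 * D' * x k - (\<Sum>i<Suc s. a' i * c i k) = M\<^sup>2 * ?w k"
            by (simp add: power2_eq_square algebra_simps)
        qed
        then have "B (\<lambda>k. M\<^sup>2 * D' * x k - (\<Sum>i<Suc s. a' i * c i k))
            (\<lambda>k. M\<^sup>2 * D' * x k - (\<Sum>i<Suc s. a' i * c i k)) = M\<^sup>2 * (M\<^sup>2 * B ?w ?w)"
          by (simp only: scale_left scale_right)
        also have "\<dots> = 0" unfolding u by simp
        finally have zero: "B (\<lambda>k. M\<^sup>2 * D' * x k - (\<Sum>i<Suc s. a' i * c i k))
            (\<lambda>k. M\<^sup>2 * D' * x k - (\<Sum>i<Suc s. a' i * c i k)) = 0" .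
        show ?thesis by (rule exI[of _ a']) (rule zero)
      qed
      ultimately have "?goal (Suc s) c" using s by blast
      then show ?thesis by blast
    qed
  qed
qed

section \<open>Diagonally dominant forms as sums of squares\<close>

definition pair_form :: "(nat \<Rightarrow> int) \<Rightarrow> nat \<Rightarrow> nat \<Rightarrow> int" where
  "pair_form a i j = (if i = j then a i else if i < j then a i + a j else a i - a j)"

text \<open>For a symmetric matrix \<open>b\<close> of size \<open>s\<close>, the coefficient of the square of \<open>pair_form a i j\<close>. The entries
above the diagonal collect the positive \<open>b i j\<close>, those below it the negative ones; the diagonal
keeps what the off-diagonal squares leave over. The padding by zeros allows sums of a length
that does not depend on \<open>s\<close>.\<close>

definition weight :: "nat \<Rightarrow> (nat \<Rightarrow> nat \<Rightarrow> int) \<Rightarrow> nat \<Rightarrow> nat \<Rightarrow> int" where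
  "weight s b i j =
     (if i < s \<and> j < s then
        (if i = j then b i i - (\<Sum>l\<in>{..<s} - {i}. \<bar>b i l\<bar>)
         else if i < j then max (b i j) 0 else max (- b i j) 0)
      else 0)"

text \<open>A double sum depends only on the symmetrization of its terms, so that the two entries of \<open>weight\<close>
belonging to a pair of indices can be treated together.\<close>

lemma double_sum_cong_symmetrized:
  fixes f h :: "nat \<Rightarrow> nat \<Rightarrow> int"
  assumes "\<And>i j. i < s \<Longrightarrow> j < s \<Longrightarrow> f i j + f j i = h i j + h j i"
  shows "(\<Sum>i<s. \<Sum>j<s. f i j) = (\<Sum>i<s. \<Sum>j<s. h i j)"
proof -
  have twice: "2 * (\<Sum>i<s. \<Sum>j<s. F i j) = (\<Sum>i<s. \<Sum>j<s. F i j + F j i)"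
    for F :: "nat \<Rightarrow> nat \<Rightarrow> int"
    using sum.swap[of F "{..<s}" "{..<s}"] by (simp add: sum.distrib)
  have "2 * (\<Sum>i<s. \<Sum>j<s. f i j) = 2 * (\<Sum>i<s. \<Sum>j<s. h i j)"
    unfolding twice by (intro sum.cong refl) (use assms in auto)
  then show ?thesis by simp
qed

text \<open>Off the diagonal, \<open>\<bar>b\<bar> (x \<plusminus> y)\<^sup>2 = \<bar>b\<bar> x\<^sup>2 + 2 b x y + \<bar>b\<bar> y\<^sup>2\<close> with the sign of \<open>b\<close>. The surplus
\<open>\<bar>b\<bar> x\<^sup>2 + \<bar>b\<bar> y\<^sup>2\<close> is subtracted on the diagonal.\<close>

lemma sum_of_weighted_squares:
  assumes sym: "\<And>i j. b i j = b j i" and "s \<le> n"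
  shows "(\<Sum>i<s. \<Sum>j<s. a i * a j * b i j) =
    (\<Sum>i<n. \<Sum>j<n. weight s b i j * (pair_form a i j)\<^sup>2)"
proof -
  define h where "h i j = (if i = j then weight s b i i * (a i)\<^sup>2
      else \<bar>b i j\<bar> * (a i)\<^sup>2 + a i * a j * b i j)" for i j
  have "(\<Sum>i<s. \<Sum>j<s. weight s b i j * (pair_form a i j)\<^sup>2) = (\<Sum>i<s. \<Sum>j<s. h i j)"
  proof (rule double_sum_cong_symmetrized)
    have lt: "weight s b i j * (pair_form a i j)\<^sup>2 + weight s b j i * (pair_form a j i)\<^sup>2 = h i j + h j i"
      if "i < s" "j < s" "i < j" for i j
    proof (cases "b i j \<ge> 0")
      case True
      then show ?thesis using that sym[of j i]
        by (simp add: weight_def pair_form_def h_def max_def power2_eq_square algebra_simps)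
    next
      case False
      then show ?thesis using that sym[of j i]
        by (simp add: weight_def pair_form_def h_def max_def power2_eq_square algebra_simps)
    qed
    fix i j assume ij: "i < s" "j < s"
    show "weight s b i j * (pair_form a i j)\<^sup>2 + weight s b j i * (pair_form a j i)\<^sup>2 = h i j + h j i"
    proof (cases i j rule: linorder_cases)
      case less
      then show ?thesis using lt ij by simp
    next
      case equal
      then show ?thesis by (simp add: h_def pair_form_def)
    next
      case greater
      then show ?thesis using lt[of j i] ij by simp
    qed
  qed
  also have "\<dots> = (\<Sum>i<s. \<Sum>j<s. a i * a j * b i j)"
  proof (rule sum.cong[OF refl])
    fix i assume "i \<in> {..<s}"
    then have i: "i < s" by simp
    have "(\<Sum>j<s. h i j) = h i i + (\<Sum>j\<in>{..<s} - {i}. h i j)"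
      using i by (subst sum.remove[of _ i]) auto
    also have "(\<Sum>j\<in>{..<s} - {i}. h i j) = (\<Sum>j\<in>{..<s} - {i}. \<bar>b i j\<bar>) * (a i)\<^sup>2 + (\<Sum>j\<in>{..<s} - {i}. a i * a j * b i j)"
      by (simp add: h_def sum.distrib sum_distrib_right)
    also have "h i i + \<dots> = a i * a i * b i i + (\<Sum>j\<in>{..<s} - {i}. a i * a j * b i j)"
      using i by (simp add: h_def weight_def power2_eq_square algebra_simps)
    also have "\<dots> = (\<Sum>j<s. a i * a j * b i j)"
      using i by (subst (2) sum.remove[of _ i]) auto
    finally show "(\<Sum>j<s. h i j) = (\<Sum>j<s. a i * a j * b i j)" .
  qed
  also have "(\<Sum>i<s. \<Sum>j<s. weight s b i j * (pair_form a i j)\<^sup>2) =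
      (\<Sum>i<n. \<Sum>j<n. weight s b i j * (pair_form a i j)\<^sup>2)"
  proof -
    have "(\<Sum>i<s. \<Sum>j<s. weight s b i j * (pair_form a i j)\<^sup>2) =
        (\<Sum>i<s. \<Sum>j<n. weight s b i j * (pair_form a i j)\<^sup>2)"
      using assms(2) by (intro sum.cong sum.mono_neutral_left) (auto simp: weight_def)
    also have "\<dots> = (\<Sum>i<n. \<Sum>j<n. weight s b i j * (pair_form a i j)\<^sup>2)"
      using assms(2) by (intro sum.mono_neutral_left) (auto simp: weight_def)
    finally show ?thesis .
  qed
  finally show ?thesis by simp
qed

lemma weight_nonneg_diagonal_pos:
  assumes dom: "\<And>i j. i < s \<Longrightarrow> j < s \<Longrightarrow> i \<noteq> j \<Longrightarrow> int s * \<bar>b i j\<bar> \<le> b i i"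
    and pos: "\<And>i. i < s \<Longrightarrow> b i i > 0"
  shows "weight s b i j \<ge> 0" and "i < s \<Longrightarrow> weight s b i i > 0"
proof -
  show diag: "weight s b i i > 0" if i: "i < s" for i
  proof -
    have "int s * (\<Sum>l\<in>{..<s} - {i}. \<bar>b i l\<bar>) \<le> (\<Sum>l\<in>{..<s} - {i}. b i i)"
      unfolding sum_distrib_left by (intro sum_mono dom) (use i in auto)
    also have "\<dots> = (int s - 1) * b i i" using i by (simp add: of_nat_diff)
    also have "\<dots> < int s * b i i" using pos[OF i] by (simp add: algebra_simps)
    finally have "(\<Sum>l\<in>{..<s} - {i}. \<bar>b i l\<bar>) < b i i" using i by simp
    then show ?thesis using i by (simp add: weight_def)
  qed
  show "weight s b i j \<ge> 0"
    using diag[of i] by (cases "i = j") (auto simp: weight_def less_imp_le)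
qed

section \<open>Dickson's lemma\<close>

text \<open>Induction on the set of coordinates. A set that suffices for the other coordinates deals with all elements
whose new coordinate is at least some bound; below the bound there are finitely many values, and
each of their fibres is dealt with separately.\<close>

lemma dickson:
  fixes \<kappa> :: "'b \<Rightarrow> 'v \<Rightarrow> nat"
  assumes "finite V"
  shows "\<exists>F\<subseteq>A. finite F \<and> (\<forall>x\<in>A. \<exists>f\<in>F. \<forall>v\<in>V. \<kappa> f v \<le> \<kappa> x v)"
  using assms
proof (induction V arbitrary: A rule: finite_induct)
  case empty
  show ?case
  proof (cases "A = {}")
    case True
    then show ?thesis by auto
  next
    case False
    then obtain x where "x \<in> A" by blast
    then show ?thesis by (intro exI[of _ "{x}"]) auto
  qed
next
  case (insert v V)
  obtain F where F: "F \<subseteq> A" "finite F" "\<forall>x\<in>A. \<exists>f\<in>F. \<forall>w\<in>V. \<kappa> f w \<le> \<kappa> x w"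
    using insert.IH[of A] by auto
  obtain N where N: "\<forall>f\<in>F. \<kappa> f v < N"
    using F(2) finite_nat_set_iff_bounded[of "(\<lambda>f. \<kappa> f v) ` F"] by auto
  have "\<forall>t. \<exists>E. E \<subseteq> {x\<in>A. \<kappa> x v = t} \<and> finite E \<and>
      (\<forall>x\<in>{x\<in>A. \<kappa> x v = t}. \<exists>f\<in>E. \<forall>w\<in>V. \<kappa> f w \<le> \<kappa> x w)"
    by (intro allI insert.IH)
  from choice[OF this] obtain E where "\<forall>t. E t \<subseteq> {x\<in>A. \<kappa> x v = t} \<and> finite (E t) \<and>
      (\<forall>x\<in>{x\<in>A. \<kappa> x v = t}. \<exists>f\<in>E t. \<forall>w\<in>V. \<kappa> f w \<le> \<kappa> x w)" ..
  then have E: "\<And>t. E t \<subseteq> {x\<in>A. \<kappa> x v = t}" "\<And>t. finite (E t)"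
      "\<And>t x. x \<in> A \<Longrightarrow> \<kappa> x v = t \<Longrightarrow> \<exists>f\<in>E t. \<forall>w\<in>V. \<kappa> f w \<le> \<kappa> x w"
    by blast+
  show ?case
  proof (intro exI[of _ "F \<union> (\<Union>t<N. E t)"] conjI ballI)
    show "F \<union> (\<Union>t<N. E t) \<subseteq> A" using F(1) E(1) by blast
    show "finite (F \<union> (\<Union>t<N. E t))" using F(2) E(2) by auto
    fix x assume x: "x \<in> A"
    obtain f where f: "f \<in> F" "\<forall>w\<in>V. \<kappa> f w \<le> \<kappa> x w" using F(3) x by blast
    show "\<exists>f\<in>F \<union> (\<Union>t<N. E t). \<forall>w\<in>insert v V. \<kappa> f w \<le> \<kappa> x w"
    proof (cases "\<kappa> f v \<le> \<kappa> x v")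
      case True
      then show ?thesis using f by auto
    next
      case False
      then have lt: "\<kappa> x v < N" using N f(1) by force
      obtain e where e: "e \<in> E (\<kappa> x v)" "\<forall>w\<in>V. \<kappa> e w \<le> \<kappa> x w" using E(3)[OF x refl] by blast
      then have "\<kappa> e v = \<kappa> x v" using E(1) by blast
      then show ?thesis using e lt by (intro bexI[of _ e]) auto
    qed
  qed
qed

lemma dickson_classes:
  fixes \<kappa> :: "'b \<Rightarrow> 'v \<Rightarrow> nat" and \<gamma> :: "'b \<Rightarrow> 'c"
  assumes "finite V" and fin: "finite (\<gamma> ` A)"
  shows "\<exists>F\<subseteq>A. finite F \<and> (\<forall>x\<in>A. \<exists>f\<in>F. \<gamma> f = \<gamma> x \<and> (\<forall>v\<in>V. \<kappa> f v \<le> \<kappa> x v))"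
proof -
  have "\<forall>g. \<exists>F. F \<subseteq> {x\<in>A. \<gamma> x = g} \<and> finite F \<and>
      (\<forall>x\<in>{x\<in>A. \<gamma> x = g}. \<exists>f\<in>F. \<forall>v\<in>V. \<kappa> f v \<le> \<kappa> x v)"
    by (intro allI dickson[OF assms(1)])
  from choice[OF this] obtain F where "\<forall>g. F g \<subseteq> {x\<in>A. \<gamma> x = g} \<and> finite (F g) \<and>
      (\<forall>x\<in>{x\<in>A. \<gamma> x = g}. \<exists>f\<in>F g. \<forall>v\<in>V. \<kappa> f v \<le> \<kappa> x v)" ..
  then have F: "\<And>g. F g \<subseteq> {x\<in>A. \<gamma> x = g}" "\<And>g. finite (F g)"
      "\<And>g x. x \<in> A \<Longrightarrow> \<gamma> x = g \<Longrightarrow> \<exists>f\<in>F g. \<forall>v\<in>V. \<kappa> f v \<le> \<kappa> x v"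
    by blast+
  show ?thesis
  proof (intro exI[of _ "\<Union>g\<in>\<gamma> ` A. F g"] conjI ballI)
    show "(\<Union>g\<in>\<gamma> ` A. F g) \<subseteq> A" using F(1) by blast
    show "finite (\<Union>g\<in>\<gamma> ` A. F g)" using fin F(2) by blast
    fix x assume x: "x \<in> A"
    obtain f where "f \<in> F (\<gamma> x)" "\<forall>v\<in>V. \<kappa> f v \<le> \<kappa> x v" using F(3)[OF x refl] by blast
    then show "\<exists>f\<in>\<Union>g\<in>\<gamma> ` A. F g. \<gamma> f = \<gamma> x \<and> (\<forall>v\<in>V. \<kappa> f v \<le> \<kappa> x v)"
      using F(1) x by blast
  qed
qed

section \<open>Lattices, representations and orthogonal sums\<close>

definition form :: "int mat \<Rightarrow> (nat \<Rightarrow> int) \<Rightarrow> (nat \<Rightarrow> int) \<Rightarrow> int" where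
  "form G x y = (\<Sum>i<dim_row G. \<Sum>j<dim_row G. x i * G $$ (i, j) * y j)"

definition norm1_free :: "int mat \<Rightarrow> bool" where
  "norm1_free G \<longleftrightarrow> (\<forall>x. form G x x \<noteq> 1)"

text \<open>Maps between function spaces stand for maps between lattices of any ranks; only the values at the
first arguments, as many as the rank, are relevant.\<close>

definition linear_map :: "((nat \<Rightarrow> int) \<Rightarrow> nat \<Rightarrow> int) \<Rightarrow> bool" where
  "linear_map f \<longleftrightarrow> (\<forall>a x b y. f (\<lambda>k. a * x k + b * y k) = (\<lambda>k. a * f x k + b * f y k))"

lemma form_cong:
  assumes "\<And>i. i < dim_row G \<Longrightarrow> x i = x' i" "\<And>i. i < dim_row G \<Longrightarrow> y i = y' i"
  shows "form G x y = form G x' y'"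
  unfolding form_def by (intro sum.cong refl) (use assms in auto)

lemma bilin_eq_form:
  assumes "G \<in> carrier_mat m m" "u \<in> carrier_vec m" "v \<in> carrier_vec m"
  shows "bilin G u v = form G (\<lambda>k. u $ k) (\<lambda>k. v $ k)"
  using assms unfolding bilin_def form_def scalar_prod_def
  by (auto simp: scalar_prod_def row_def sum_distrib_left atLeast0LessThan mult.assoc intro!: sum.cong)

lemma form_eq_bilin:
  assumes "G \<in> carrier_mat m m"
  shows "form G x y = bilin G (vec m x) (vec m y)"
  using assms by (subst bilin_eq_form[OF assms]) (auto intro!: form_cong)

lemma form_linear:
  "form G (\<lambda>k. a * x k + b * y k) z = a * form G x z + b * form G y z"
  unfolding form_def by (simp add: sum_distrib_left sum.distrib[symmetric] algebra_simps)

lemma is_lattice_iff: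
  "is_lattice m G \<longleftrightarrow> G \<in> carrier_mat m m \<and> (\<forall>x y. form G x y = form G y x) \<and>
     (\<forall>x. (\<exists>i<m. x i \<noteq> 0) \<longrightarrow> form G x x > 0)"
proof
  assume L: "is_lattice m G"
  then have G: "G \<in> carrier_mat m m" by (simp add: is_lattice_def)
  have "form G x y = form G y x" for x y
    using L unfolding form_eq_bilin[OF G] by (simp add: is_lattice_def)
  moreover have "form G x x > 0" if "\<exists>i<m. x i \<noteq> 0" for x
  proof -
    have "vec m x \<noteq> 0\<^sub>v m" using that by (metis index_vec index_zero_vec(1))
    then show ?thesis using L unfolding form_eq_bilin[OF G] by (simp add: is_lattice_def)
  qed
  ultimately show "G \<in> carrier_mat m m \<and> (\<forall>x y. form G x y = form G y x) \<and>
     (\<forall>x. (\<exists>i<m. x i \<noteq> 0) \<longrightarrow> form G x x > 0)" using G by blast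
next
  assume R: "G \<in> carrier_mat m m \<and> (\<forall>x y. form G x y = form G y x) \<and>
     (\<forall>x. (\<exists>i<m. x i \<noteq> 0) \<longrightarrow> form G x x > 0)"
  then have G: "G \<in> carrier_mat m m" by blast
  have "bilin G u u > 0" if "u \<in> carrier_vec m" "u \<noteq> 0\<^sub>v m" for u
  proof -
    have "\<exists>i<m. u $ i \<noteq> 0" using that by (metis carrier_vecD eq_vecI index_zero_vec)
    then show ?thesis using R that by (simp add: bilin_eq_form[OF G])
  qed
  then show "is_lattice m G" using R by (auto simp: is_lattice_def bilin_eq_form[OF G])
qed

lemma is_lattice_carrier: "is_lattice m G \<Longrightarrow> G \<in> carrier_mat m m"
  by (simp add: is_lattice_def)

lemma is_lattice_dim: "is_lattice m G \<Longrightarrow> dim_row G = m"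
  by (auto simp: is_lattice_def)

lemma psd_form_lattice:
  assumes "is_lattice m G"
  shows "psd_form (form G)"
proof
  show "form G x y = form G y x" for x y using assms by (simp add: is_lattice_iff)
  show "0 \<le> form G x x" for x
  proof (cases "\<exists>i<m. x i \<noteq> 0")
    case True
    then show ?thesis using assms by (simp add: is_lattice_iff less_imp_le)
  next
    case False
    then have "form G x x = form G (\<lambda>_. 0) (\<lambda>_. 0)"
      using is_lattice_dim[OF assms] by (intro form_cong) auto
    then show ?thesis by (simp add: form_def)
  qed
qed (rule form_linear)

lemma form_eq_0_iff:
  assumes "is_lattice m G"
  shows "form G x x = 0 \<longleftrightarrow> (\<forall>i<m. x i = 0)"
proof
  assume "form G x x = 0"
  then show "\<forall>i<m. x i = 0" using assms unfolding is_lattice_iff by (metis less_irrefl)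
next
  assume "\<forall>i<m. x i = 0"
  then have "form G x x = form G (\<lambda>_. 0) (\<lambda>_. 0)"
    using is_lattice_dim[OF assms] by (intro form_cong) auto
  then show "form G x x = 0" by (simp add: form_def)
qed

text \<open>The \<open>m + 1\<close> vectors are the columns of a square matrix completed by a zero row. It is singular, so its
columns are linearly dependent.\<close>

lemma rank_le_lattice:
  assumes L: "is_lattice m G"
  shows "psd_form.rank_le (form G) m"
  unfolding psd_form.rank_le_def[OF psd_form_lattice[OF L]]
proof
  fix v :: "nat \<Rightarrow> nat \<Rightarrow> int"
  define A where "A = mat (Suc m) (Suc m) (\<lambda>(k, i). if k < m then v i k else 0)"
  have A: "A \<in> carrier_mat (Suc m) (Suc m)" by (simp add: A_def)
  have "transpose_mat A *\<^sub>v unit_vec (Suc m) m = 0\<^sub>v (Suc m)"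
    by (rule eq_vecI) (auto simp: A_def)
  moreover have "unit_vec (Suc m) m \<noteq> (0\<^sub>v (Suc m) :: int vec)"
    by (metis index_unit_vec(1) index_zero_vec(1) lessI zero_neq_one)
  ultimately have "det (transpose_mat A) = 0"
    using A by (subst det_0_iff_vec_prod_zero[of _ "Suc m"]) (auto intro!: exI[of _ "unit_vec (Suc m) m"])
  then have "det A = 0" using det_transpose[OF A] by simp
  then obtain u where u: "u \<in> carrier_vec (Suc m)" "u \<noteq> 0\<^sub>v (Suc m)" "A *\<^sub>v u = 0\<^sub>v (Suc m)"
    using det_0_iff_vec_prod_zero[OF A] by blast
  have "(\<Sum>i<Suc m. u $ i * v i k) = 0" if k: "k < m" for k
  proof -
    have "0 = (A *\<^sub>v u) $ k" using u(3) k by simp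
    also have "\<dots> = (\<Sum>i<Suc m. u $ i * v i k)"
      using k u(1) by (simp add: A_def scalar_prod_def atLeast0LessThan mult.commute)
    finally show ?thesis by simp
  qed
  then have "form G (\<lambda>k. \<Sum>i<Suc m. u $ i * v i k) (\<lambda>k. \<Sum>i<Suc m. u $ i * v i k) = 0"
    unfolding form_eq_0_iff[OF L] by blast
  moreover have "\<exists>i<Suc m. u $ i \<noteq> 0" using u(1,2) by (metis carrier_vecD eq_vecI index_zero_vec)
  ultimately show "\<exists>a. (\<exists>i<Suc m. a i \<noteq> 0) \<and>
      form G (\<lambda>k. \<Sum>i<Suc m. a i * v i k) (\<lambda>k. \<Sum>i<Suc m. a i * v i k) = 0"
    by (intro exI[of _ "\<lambda>i. u $ i"]) blast
qed

text \<open>It suffices to preserve norms: polarization gives the bilinear form, and injectivity follows from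
definiteness.\<close>

lemma representsI:
  assumes L: "is_lattice m L" and l: "is_lattice n l" and f: "linear_map f"
    and q: "\<And>x. form L (f x) (f x) = form l x x"
  shows "represents L l"
proof -
  interpret L: psd_form "form L" by (rule psd_form_lattice[OF L])
  interpret l: psd_form "form l" by (rule psd_form_lattice[OF l])
  have B: "form L (f x) (f y) = form l x y" for x y
  proof -
    have fd: "f (\<lambda>k. 1 * x k + (-1) * y k) = (\<lambda>k. 1 * f x k + (-1) * f y k)"
      using f unfolding linear_map_def by blast
    have "form L (\<lambda>k. f x k - f y k) (\<lambda>k. f x k - f y k) = form l (\<lambda>k. x k - y k) (\<lambda>k. x k - y k)"
      using q[of "\<lambda>k. x k - y k"] fd by simp
    then show ?thesis unfolding L.quad_diff l.quad_diff using q[of x] q[of y] by simp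
  qed
  define e where "e v k = (if k < n then v $ k else 0)" for v :: "int vec" and k
  define F where "F v = vec m (f (e v))" for v
  have e_add: "e (x + y) = (\<lambda>k. 1 * e x k + 1 * e y k)" if "x \<in> carrier_vec n" "y \<in> carrier_vec n" for x y
    using that by (auto simp: e_def)
  have e_smult: "e (a \<cdot>\<^sub>v x) = (\<lambda>k. a * e x k + 0 * e x k)" if "x \<in> carrier_vec n" for a x
    using that by (auto simp: e_def)
  have "Z_linear n m F"
    unfolding Z_linear_def F_def
  proof (intro conjI ballI allI)
    fix x y :: "int vec" assume xy: "x \<in> carrier_vec n" "y \<in> carrier_vec n"
    have "f (e (x + y)) = (\<lambda>k. 1 * f (e x) k + 1 * f (e y) k)"
      unfolding e_add[OF xy] using f unfolding linear_map_def by blast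
    then show "vec m (f (e (x + y))) = vec m (f (e x)) + vec m (f (e y))" by auto
  next
    fix a and x :: "int vec" assume x: "x \<in> carrier_vec n"
    have "f (e (a \<cdot>\<^sub>v x)) = (\<lambda>k. a * f (e x) k + 0 * f (e x) k)"
      unfolding e_smult[OF x] using f unfolding linear_map_def by blast
    then show "vec m (f (e (a \<cdot>\<^sub>v x))) = a \<cdot>\<^sub>v vec m (f (e x))" by auto
  qed auto
  moreover have pres: "bilin L (F x) (F y) = bilin l x y" if xy: "x \<in> carrier_vec n" "y \<in> carrier_vec n" for x y
  proof -
    have "bilin L (F x) (F y) = form L (f (e x)) (f (e y))"
      unfolding F_def by (rule form_eq_bilin[OF is_lattice_carrier[OF L], symmetric])
    also have "\<dots> = form l (e x) (e y)" by (rule B)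
    also have "\<dots> = form l (\<lambda>k. x $ k) (\<lambda>k. y $ k)"
      using is_lattice_dim[OF l] by (intro form_cong) (auto simp: e_def)
    also have "\<dots> = bilin l x y" using bilin_eq_form[OF is_lattice_carrier[OF l] xy] by simp
    finally show ?thesis .
  qed
  moreover have "inj_on F (carrier_vec n)"
  proof (rule inj_onI)
    fix x y assume x: "x \<in> carrier_vec n" and y: "y \<in> carrier_vec n" and eq: "F x = F y"
    have "form l (e x) (e x) - 2 * form l (e x) (e y) + form l (e y) (e y) = 0"
    proof -
      have "form l (e x) (e y) = form l (e x) (e x)" "form l (e y) (e y) = form l (e x) (e x)"
        using eq unfolding B[symmetric] form_eq_bilin[OF is_lattice_carrier[OF L]] F_def[symmetric] by simp_all
      then show ?thesis by simp
    qed
    then have "\<forall>i<n. e x i - e y i = 0"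
      unfolding l.quad_diff[symmetric] form_eq_0_iff[OF l] .
    then show "x = y" using x y by (intro eq_vecI) (auto simp: e_def)
  qed
  ultimately show ?thesis
    unfolding represents_def preserves_form_def using is_lattice_dim[OF L] is_lattice_dim[OF l] by auto
qed

lemma representsE:
  assumes L: "is_lattice m L" and l: "is_lattice n l" and "represents L l"
  obtains f where "linear_map f" "\<And>x y. form L (f x) (f y) = form l x y"
proof -
  obtain F where F: "Z_linear n m F" "preserves_form l L F"
    using assms(3) is_lattice_dim[OF L] is_lattice_dim[OF l] unfolding represents_def by auto
  have Fc: "F u \<in> carrier_vec m" if "u \<in> carrier_vec n" for u
    using F(1) that unfolding Z_linear_def by auto
  define f where "f x k = (if k < m then F (vec n x) $ k else 0)" for x k
  show ?thesis
  proof (rule that)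
    have "F (vec n (\<lambda>k. a * x k + b * y k)) = a \<cdot>\<^sub>v F (vec n x) + b \<cdot>\<^sub>v F (vec n y)" for a x b y
    proof -
      have "vec n (\<lambda>k. a * x k + b * y k) = a \<cdot>\<^sub>v vec n x + b \<cdot>\<^sub>v vec n y" by auto
      then show ?thesis using F(1) by (auto simp: Z_linear_def)
    qed
    then show "linear_map f"
      unfolding linear_map_def f_def using Fc
      by (auto intro!: ext simp: carrier_vecD[OF Fc])
    show "form L (f x) (f y) = form l x y" for x y
    proof -
      have "form L (f x) (f y) = form L (\<lambda>k. F (vec n x) $ k) (\<lambda>k. F (vec n y) $ k)"
        using is_lattice_dim[OF L] by (intro form_cong) (auto simp: f_def)
      also have "\<dots> = bilin L (F (vec n x)) (F (vec n y))"
        by (rule bilin_eq_form[OF is_lattice_carrier[OF L] Fc Fc, symmetric]) auto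
      also have "\<dots> = bilin l (vec n x) (vec n y)"
        using F(2) is_lattice_dim[OF l] by (simp add: preserves_form_def)
      finally show ?thesis by (simp add: form_eq_bilin[OF is_lattice_carrier[OF l]])
    qed
  qed
qed

definition orth_sum :: "int mat \<Rightarrow> int mat \<Rightarrow> int mat" where
  "orth_sum A B = four_block_mat A (0\<^sub>m (dim_row A) (dim_row B)) (0\<^sub>m (dim_row B) (dim_row A)) B"

lemma sum_lessThan_add:
  fixes F :: "nat \<Rightarrow> int"
  shows "(\<Sum>i<a + b. F i) = (\<Sum>i<a. F i) + (\<Sum>i<b. F (a + i))"
  by (induction b) auto

lemma form_orth_sum:
  assumes "A \<in> carrier_mat a a" "B \<in> carrier_mat b b"
  shows "form (orth_sum A B) x y = form A x y + form B (\<lambda>k. x (a + k)) (\<lambda>k. y (a + k))"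
proof -
  have d: "dim_row A = a" "dim_col A = a" "dim_row B = b" "dim_col B = b" using assms by auto
  show ?thesis
    unfolding form_def orth_sum_def using d by (simp add: sum_lessThan_add)
qed

lemma is_lattice_orth_sum:
  assumes A: "is_lattice a A" and B: "is_lattice b B"
  shows "is_lattice (a + b) (orth_sum A B)"
proof -
  have cA: "A \<in> carrier_mat a a" and cB: "B \<in> carrier_mat b b"
    using A B by (simp_all add: is_lattice_carrier)
  interpret A: psd_form "form A" by (rule psd_form_lattice[OF A])
  interpret B: psd_form "form B" by (rule psd_form_lattice[OF B])
  show ?thesis
    unfolding is_lattice_iff form_orth_sum[OF cA cB]
  proof (intro conjI allI impI)
    show "orth_sum A B \<in> carrier_mat (a + b) (a + b)" using cA cB by (auto simp: orth_sum_def)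
    show "form A x y + form B (\<lambda>k. x (a + k)) (\<lambda>k. y (a + k)) =
        form A y x + form B (\<lambda>k. y (a + k)) (\<lambda>k. x (a + k))" for x y
      using A.symmetric B.symmetric by metis
    fix x :: "nat \<Rightarrow> int" assume "\<exists>i<a + b. x i \<noteq> 0"
    then obtain i where i: "i < a + b" "x i \<noteq> 0" by blast
    have "form A x x \<noteq> 0 \<or> form B (\<lambda>k. x (a + k)) (\<lambda>k. x (a + k)) \<noteq> 0"
    proof (cases "i < a")
      case True
      then show ?thesis using i form_eq_0_iff[OF A] by blast
    next
      case False
      then have "i - a < b" "x (a + (i - a)) \<noteq> 0" using i by auto
      then show ?thesis unfolding form_eq_0_iff[OF B] by blast
    qed
    then show "form A x x + form B (\<lambda>k. x (a + k)) (\<lambda>k. x (a + k)) > 0"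
      using A.nonneg[of x] B.nonneg[of "\<lambda>k. x (a + k)"] by linarith
  qed
qed

lemma represents_orth_sumI:
  assumes A: "is_lattice a A" and B: "is_lattice b B" and l: "is_lattice n l"
    and f: "linear_map f" and h: "linear_map h"
    and q: "\<And>x. form l x x = form A (f x) (f x) + form B (h x) (h x)"
  shows "represents (orth_sum A B) l"
proof (rule representsI[OF is_lattice_orth_sum[OF A B] l])
  define F where "F x k = (if k < a then f x k else h x (k - a))" for x k
  show "linear_map F" using f h unfolding linear_map_def F_def by auto
  show "form (orth_sum A B) (F x) (F x) = form l x x" for x
  proof -
    have "form A (F x) (F x) = form A (f x) (f x)"
      using is_lattice_dim[OF A] by (intro form_cong) (auto simp: F_def)
    then show ?thesis
      unfolding form_orth_sum[OF is_lattice_carrier[OF A] is_lattice_carrier[OF B]] q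
      by (simp add: F_def)
  qed
qed

lemma norm1_free_orth_sum:
  assumes A: "is_lattice a A" "norm1_free A" and B: "is_lattice b B" "norm1_free B"
  shows "norm1_free (orth_sum A B)"
  unfolding norm1_free_def
proof
  fix x
  interpret A: psd_form "form A" by (rule psd_form_lattice[OF A(1)])
  interpret B: psd_form "form B" by (rule psd_form_lattice[OF B(1)])
  have "form A x x \<noteq> 1" "form B (\<lambda>k. x (a + k)) (\<lambda>k. x (a + k)) \<noteq> 1"
    using A(2) B(2) unfolding norm1_free_def by blast+
  then show "form (orth_sum A B) x x \<noteq> 1"
    unfolding form_orth_sum[OF is_lattice_carrier[OF A(1)] is_lattice_carrier[OF B(1)]]
    using A.nonneg[of x] B.nonneg[of "\<lambda>k. x (a + k)"] by arith
qed

lemma form_scaled_identity: "form (c \<cdot>\<^sub>m 1\<^sub>m m) x y = c * (\<Sum>i<m. x i * y i)"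
proof -
  have "(\<Sum>j<m. x i * (c \<cdot>\<^sub>m 1\<^sub>m m) $$ (i, j) * y j) = c * (x i * y i)" if "i < m" for i
  proof -
    have "(\<Sum>j<m. x i * (c \<cdot>\<^sub>m 1\<^sub>m m) $$ (i, j) * y j) = (\<Sum>j<m. if j = i then c * (x i * y i) else 0)"
      using that by (intro sum.cong) auto
    then show ?thesis using that by simp
  qed
  then show ?thesis by (simp add: form_def sum_distrib_left)
qed

lemma is_lattice_scaled_identity:
  assumes "c > 0"
  shows "is_lattice m (c \<cdot>\<^sub>m 1\<^sub>m m)"
  unfolding is_lattice_iff form_scaled_identity
proof (intro conjI allI impI)
  fix x :: "nat \<Rightarrow> int" assume "\<exists>i<m. x i \<noteq> 0"
  then obtain i where "i < m" "x i \<noteq> 0" by blast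
  then have "(\<Sum>i<m. x i * x i) > 0"
    by (intro sum_pos2[of _ i]) (auto simp: zero_less_mult_iff)
  then show "0 < c * (\<Sum>i<m. x i * x i)" using assms by simp
qed (auto simp: mult.commute)

lemma norm1_free_double_identity: "norm1_free (2 \<cdot>\<^sub>m 1\<^sub>m m)"
  unfolding norm1_free_def form_scaled_identity by (metis dvd_triv_left odd_one)

text \<open>The orthogonal sum of the given lattices has no vector of norm \<open>1\<close>, since the norms of its
components are nonnegative integers different from \<open>1\<close>.\<close>

lemma norm1_free_universal_for_finite:
  assumes "finite F" "\<forall>l\<in>F. is_lattice n l \<and> norm1_free l"
  shows "\<exists>m M. is_lattice m M \<and> norm1_free M \<and> (\<forall>l\<in>F. represents M l)"
  using assms
proof (induction rule: finite_induct)
  case empty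
  then show ?case using is_lattice_scaled_identity[of 2 0] norm1_free_double_identity by auto
next
  case (insert l F)
  then obtain m M where M: "is_lattice m M" "norm1_free M" "\<forall>l\<in>F. represents M l" by auto
  have l: "is_lattice n l" "norm1_free l" using insert.prems by auto
  have lin0: "linear_map (\<lambda>x k. 0)" and lin_id: "linear_map (\<lambda>x. x)" by (simp_all add: linear_map_def)
  have zero: "form G (\<lambda>k. 0) (\<lambda>k. 0) = 0" for G by (simp add: form_def)
  have "represents (orth_sum M l) l'" if l': "l' \<in> insert l F" for l'
  proof (cases "l' = l")
    case True
    then show ?thesis
      by (simp add: represents_orth_sumI[OF M(1) l(1) l(1) lin0 lin_id] zero)
  next
    case False
    then have l'F: "is_lattice n l'" "represents M l'" using l' insert.prems M(3) by auto
    obtain f where f: "linear_map f" "\<And>x y. form M (f x) (f y) = form l' x y"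
      using representsE[OF M(1) l'F] by blast
    show ?thesis
      by (rule represents_orth_sumI[OF M(1) l(1) l'F(1) f(1) lin0]) (simp add: f(2) zero)
  qed
  then show ?case
    using is_lattice_orth_sum[OF M(1) l(1)] norm1_free_orth_sum[OF M(1,2) l] by blast
qed

section \<open>A finite basis for families of lattices\<close>

text \<open>Each \<open>m v\<close> is a sum of four squares \<open>(r v l)\<^sup>2\<close>, so the numbers \<open>r v l \<cdot> \<phi> v x\<close> serve as coordinates
in \<open>\<langle>2, \<dots>, 2\<rangle>\<close>.\<close>

lemma four_squares_embedding:
  fixes \<phi> :: "'v \<Rightarrow> (nat \<Rightarrow> int) \<Rightarrow> int"
  assumes V: "finite V" and m: "\<And>v. v \<in> V \<Longrightarrow> m v \<ge> 0"
    and lin: "\<And>v a x b y. \<phi> v (\<lambda>k. a * x k + b * y k) = a * \<phi> v x + b * \<phi> v y"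
  shows "\<exists>h. linear_map h \<and> (\<forall>x. form (2 \<cdot>\<^sub>m 1\<^sub>m (card (V \<times> {..<4::nat}))) (h x) (h x) =
    2 * (\<Sum>v\<in>V. m v * (\<phi> v x)\<^sup>2))"
proof -
  define N where "N = card (V \<times> {..<4::nat})"
  have "\<exists>r. m v = (\<Sum>l<4::nat. (r l)\<^sup>2)" if v: "v \<in> V" for v
  proof -
    obtain a b c d where "m v = a\<^sup>2 + b\<^sup>2 + c\<^sup>2 + d\<^sup>2" using lagrange_four_squares[OF m[OF v]] by blast
    then show ?thesis
      by (intro exI[of _ "\<lambda>l::nat. if l = 0 then a else if l = 1 then b else if l = 2 then c else d"])
        (simp add: eval_nat_numeral)
  qed
  then obtain r where r: "\<And>v. v \<in> V \<Longrightarrow> m v = (\<Sum>l<4::nat. (r v l)\<^sup>2)" by metis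
  obtain e where e: "bij_betw e {0..<N} (V \<times> {..<4::nat})"
    using ex_bij_betw_nat_finite[of "V \<times> {..<4::nat}"] V unfolding N_def by auto
  define h where "h x t = r (fst (e t)) (snd (e t)) * \<phi> (fst (e t)) x" for x t
  have "linear_map h" unfolding linear_map_def h_def by (auto simp: lin algebra_simps)
  moreover have "form (2 \<cdot>\<^sub>m 1\<^sub>m N) (h x) (h x) = 2 * (\<Sum>v\<in>V. m v * (\<phi> v x)\<^sup>2)" for x
  proof -
    have "(\<Sum>t<N. h x t * h x t) = (\<Sum>p\<in>V \<times> {..<4::nat}. (r (fst p) (snd p))\<^sup>2 * (\<phi> (fst p) x)\<^sup>2)"
      unfolding sum.reindex_bij_betw[OF e, symmetric] atLeast0LessThan
      by (simp add: h_def power2_eq_square algebra_simps)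
    also have "\<dots> = (\<Sum>v\<in>V. \<Sum>l<4::nat. (r v l)\<^sup>2 * (\<phi> v x)\<^sup>2)"
      by (simp add: sum.cartesian_product case_prod_unfold)
    also have "\<dots> = (\<Sum>v\<in>V. m v * (\<phi> v x)\<^sup>2)"
      by (intro sum.cong refl) (simp add: r sum_distrib_right)
    finally show ?thesis unfolding form_scaled_identity by simp
  qed
  ultimately show ?thesis unfolding N_def by blast
qed

text \<open>Near orthogonality with the factor \<open>n\<close> makes the Gram matrix of the at most \<open>n\<close> vectors \<open>c\<close> strictly diagonally
dominant. The span of \<open>c\<close> contains \<open>D\<close> times the module.\<close>

definition profile :: "nat \<Rightarrow> int \<Rightarrow> int mat \<Rightarrow> nat \<Rightarrow> (nat \<Rightarrow> nat \<Rightarrow> int) \<Rightarrow> bool" where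
  "profile n D G s c \<longleftrightarrow> s \<le> n \<and> psd_form.nearly_orthogonal (form G) (int n) s c \<and>
     (\<forall>x. \<exists>a. \<forall>k<n. D * x k = (\<Sum>i<s. a i * c i k))"

lemma exists_profile:
  assumes "n > 0"
  shows "\<exists>D>0. \<forall>G. is_lattice n G \<longrightarrow> (\<exists>s c. profile n D G s c)"
proof -
  obtain D where D: "D > 0" and sys: "\<And>B. psd_form B \<Longrightarrow> psd_form.rank_le B n \<Longrightarrow>
    (\<exists>s c. s \<le> n \<and> psd_form.nearly_orthogonal B (int n) s c \<and>
      (\<forall>x. \<exists>a. B (\<lambda>k. D * x k - (\<Sum>i<s. a i * c i k)) (\<lambda>k. D * x k - (\<Sum>i<s. a i * c i k)) = 0))"
    using exists_nearly_orthogonal[of "int n" n] assms by auto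
  have "\<exists>s c. profile n D G s c" if G: "is_lattice n G" for G
    using sys[OF psd_form_lattice[OF G] rank_le_lattice[OF G]]
    unfolding profile_def form_eq_0_iff[OF G] by simp
  then show ?thesis using D by blast
qed

definition gram :: "int mat \<Rightarrow> (nat \<Rightarrow> nat \<Rightarrow> int) \<Rightarrow> nat \<Rightarrow> nat \<Rightarrow> int" where
  "gram G c i j = form G (c i) (c j)"

text \<open>The vectors \<open>a\<close> for which \<open>\<Sum> a\<^sub>i c\<^sub>i\<close> is divisible by \<open>D\<close>. For a lattice with profile \<open>c\<close>, this is a copy of
the module inside \<open>Z\<^sup>s\<close>.\<close>

definition coordinates :: "nat \<Rightarrow> int \<Rightarrow> nat \<Rightarrow> (nat \<Rightarrow> nat \<Rightarrow> int) \<Rightarrow> (nat \<Rightarrow> int) set" where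
  "coordinates n D s c = {a. (\<forall>i\<ge>s. a i = 0) \<and> (\<exists>x. \<forall>k<n. D * x k = (\<Sum>i<s. a i * c i k))}"

definition residues :: "nat \<Rightarrow> int \<Rightarrow> nat \<Rightarrow> (nat \<Rightarrow> nat \<Rightarrow> int) \<Rightarrow> (nat \<Rightarrow> int) set" where
  "residues n D s c = {a \<in> coordinates n D s c. \<forall>i<n. a i \<in> {0..<D}}"

text \<open>Changing \<open>a\<close> by a multiple of \<open>D\<close> changes the quotient by \<open>D\<close> by a combination of the \<open>c\<^sub>i\<close>. Hence the residues
determine the whole set of coordinates.\<close>

lemma coordinates_mod:
  assumes "D > 0" "s \<le> n"
  shows "a \<in> coordinates n D s c \<longleftrightarrow> (\<forall>i\<ge>s. a i = 0) \<and> (\<lambda>i. a i mod D) \<in> residues n D s c"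
proof -
  have split: "(\<Sum>i<s. a i * c i k) = (\<Sum>i<s. (a i mod D) * c i k) + D * (\<Sum>i<s. (a i div D) * c i k)" for k
  proof -
    have "a i * c i k = (a i mod D) * c i k + D * ((a i div D) * c i k)" for i
      by (metis distrib_right mod_mult_div_eq mult.assoc)
    then show ?thesis by (simp add: sum.distrib sum_distrib_left)
  qed
  have "(\<exists>x. \<forall>k<n. D * x k = (\<Sum>i<s. a i * c i k)) \<longleftrightarrow>
      (\<exists>x. \<forall>k<n. D * x k = (\<Sum>i<s. (a i mod D) * c i k))"
  proof
    assume "\<exists>x. \<forall>k<n. D * x k = (\<Sum>i<s. a i * c i k)"
    then obtain x where "\<forall>k<n. D * x k = (\<Sum>i<s. a i * c i k)" by blast
    then show "\<exists>x. \<forall>k<n. D * x k = (\<Sum>i<s. (a i mod D) * c i k)"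
      unfolding split by (intro exI[of _ "\<lambda>k. x k - (\<Sum>i<s. (a i div D) * c i k)"]) (simp add: right_diff_distrib)
  next
    assume "\<exists>x. \<forall>k<n. D * x k = (\<Sum>i<s. (a i mod D) * c i k)"
    then obtain x where "\<forall>k<n. D * x k = (\<Sum>i<s. (a i mod D) * c i k)" by blast
    then show "\<exists>x. \<forall>k<n. D * x k = (\<Sum>i<s. a i * c i k)"
      unfolding split by (intro exI[of _ "\<lambda>k. x k + (\<Sum>i<s. (a i div D) * c i k)"]) (simp add: distrib_left)
  qed
  then show ?thesis using assms(1) by (auto simp: coordinates_def residues_def)
qed

lemma form_combination:
  assumes G: "is_lattice n G" and s: "s \<le> n"
  shows "form G (\<lambda>k. \<Sum>i<s. a i * c i k) (\<lambda>k. \<Sum>i<s. a i * c i k) =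
    (\<Sum>i<n. \<Sum>j<n. weight s (gram G c) i j * (pair_form a i j)\<^sup>2)"
proof -
  interpret psd_form "form G" by (rule psd_form_lattice[OF G])
  have "form G (\<lambda>k. \<Sum>i<s. a i * c i k) (\<lambda>k. \<Sum>i<s. a i * c i k) =
      (\<Sum>i<s. \<Sum>j<s. a i * a j * gram G c i j)"
    unfolding sum_left unfolding sum_right gram_def by (simp add: sum_distrib_left mult.assoc)
  also have "\<dots> = (\<Sum>i<n. \<Sum>j<n. weight s (gram G c) i j * (pair_form a i j)\<^sup>2)"
    by (rule sum_of_weighted_squares[OF _ s]) (simp add: gram_def symmetric)
  finally show ?thesis .
qed

lemma profile_weights:
  assumes G: "is_lattice n G" and p: "profile n D G s c"
  shows "weight s (gram G c) i j \<ge> 0" and "i < s \<Longrightarrow> weight s (gram G c) i i > 0"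
proof -
  interpret psd_form "form G" by (rule psd_form_lattice[OF G])
  have pos: "gram G c i i > 0" if "i < s" for i
    using p that by (simp add: profile_def nearly_orthogonal_def gram_def)
  have dom: "int s * \<bar>gram G c i j\<bar> \<le> gram G c i i" if "i < s" "j < s" "i \<noteq> j" for i j
  proof -
    have "int s * \<bar>gram G c i j\<bar> \<le> int n * \<bar>gram G c i j\<bar>"
      using p by (intro mult_right_mono) (auto simp: profile_def)
    also have "\<dots> \<le> gram G c i i"
      using p that by (simp add: profile_def nearly_orthogonal_def gram_def)
    finally show ?thesis .
  qed
  show "weight s (gram G c) i j \<ge> 0" "i < s \<Longrightarrow> weight s (gram G c) i i > 0"
    using weight_nonneg_diagonal_pos[of s "gram G c"] dom pos by auto
qed

text \<open>In the weighted sum of squares for the norm of a combination, strict diagonal dominance gives each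
\<open>a\<^sub>i\<^sup>2\<close> a positive weight.\<close>

lemma profile_independent:
  assumes G: "is_lattice n G" and p: "profile n D G s c"
    and z: "\<And>k. k < n \<Longrightarrow> (\<Sum>i<s. a i * c i k) = 0" and i: "i < s"
  shows "a i = 0"
proof -
  have s: "s \<le> n" using p by (simp add: profile_def)
  have "form G (\<lambda>k. \<Sum>i<s. a i * c i k) (\<lambda>k. \<Sum>i<s. a i * c i k) = 0"
    unfolding form_eq_0_iff[OF G] using z by blast
  then have sum0: "(\<Sum>i<n. \<Sum>j<n. weight s (gram G c) i j * (pair_form a i j)\<^sup>2) = 0"
    by (simp add: form_combination[OF G s])
  have nn: "0 \<le> weight s (gram G c) i j * (pair_form a i j)\<^sup>2" for i j
    using profile_weights(1)[OF G p] by simp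
  have "weight s (gram G c) i i * (pair_form a i i)\<^sup>2 = 0"
    using sum0 nn i s by (simp add: sum_nonneg_eq_0_iff sum_nonneg)
  then show ?thesis using profile_weights(2)[OF G p i] by (simp add: pair_form_def)
qed

text \<open>Since both lattices have the same coordinate vectors, each \<open>x\<close> in \<open>G\<close> has a partner \<open>u\<close> in \<open>G0\<close> with the
same coordinates \<open>a\<close>, and \<open>u\<close> and \<open>a\<close> depend linearly on \<open>x\<close>. The norms of \<open>x\<close> and \<open>u\<close> differ by a sum
of squares of linear forms in \<open>a\<close> with even nonnegative coefficients, which the four squares theorem
places in \<open>\<langle>2, \<dots>, 2\<rangle>\<close>.\<close>

lemma represents_of_dominated_weights:
  assumes D: "D > 0" and G0: "is_lattice n G0" and G: "is_lattice n G"
    and p0: "profile n D G0 s c0" and p: "profile n D G s c"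
    and res: "residues n D s c0 = residues n D s c"
    and le: "\<And>i j. i < n \<Longrightarrow> j < n \<Longrightarrow> weight s (gram G0 c0) i j \<le> weight s (gram G c) i j"
    and cong: "\<And>i j. i < n \<Longrightarrow> j < n \<Longrightarrow>
      weight s (gram G0 c0) i j mod (2 * D\<^sup>2) = weight s (gram G c) i j mod (2 * D\<^sup>2)"
  shows "represents (orth_sum G0 (2 \<cdot>\<^sub>m 1\<^sub>m (card (({..<n} \<times> {..<n}) \<times> {..<4::nat})))) G"
proof -
  have s: "s \<le> n" using p by (simp add: profile_def)
  have coords: "coordinates n D s c0 = coordinates n D s c"
    using res coordinates_mod[OF D s] by blast
  \<comment> \<open>\<open>R x (u, a)\<close> is the graph of the map taking \<open>x\<close> to its partner and its coordinates; the values at irrelevant arguments are fixed to be zero, which makes the map unique and hence linear\<close>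
  define R where "R x ua \<longleftrightarrow> (\<forall>k\<ge>n. fst ua k = 0) \<and> (\<forall>i\<ge>s. snd ua i = 0) \<and>
      (\<forall>k<n. D * x k = (\<Sum>i<s. snd ua i * c i k)) \<and>
      (\<forall>k<n. D * fst ua k = (\<Sum>i<s. snd ua i * c0 i k))"
    for x :: "nat \<Rightarrow> int" and ua :: "(nat \<Rightarrow> int) \<times> (nat \<Rightarrow> int)"
  have R_ex: "\<exists>ua. R x ua" for x
  proof -
    obtain a where a: "\<forall>k<n. D * x k = (\<Sum>i<s. a i * c i k)" using p by (auto simp: profile_def)
    define a' where "a' i = (if i < s then a i else 0)" for i
    have "\<forall>k<n. D * x k = (\<Sum>i<s. a' i * c i k)" using a by (simp add: a'_def)
    then have "a' \<in> coordinates n D s c" by (auto simp: coordinates_def a'_def)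
    then have "a' \<in> coordinates n D s c0" using coords by simp
    then obtain u where "\<forall>k<n. D * u k = (\<Sum>i<s. a' i * c0 i k)" by (auto simp: coordinates_def)
    then show ?thesis using a
      by (intro exI[of _ "(\<lambda>k. if k < n then u k else 0, a')"]) (simp add: R_def a'_def)
  qed
  have R_unique: "ua = vb" if "R x ua" "R x vb" for x ua vb
  proof -
    have "snd ua i = snd vb i" for i
    proof (cases "i < s")
      case True
      have "(\<Sum>i<s. (snd ua i - snd vb i) * c i k) = 0" if "k < n" for k
      proof -
        have "(\<Sum>i<s. (snd ua i - snd vb i) * c i k) = (\<Sum>i<s. snd ua i * c i k) - (\<Sum>i<s. snd vb i * c i k)"
          by (simp add: left_diff_distrib sum_subtractf)
        also have "\<dots> = D * x k - D * x k" using \<open>R x ua\<close> \<open>R x vb\<close> that by (simp add: R_def)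
        finally show ?thesis by simp
      qed
      then have "snd ua i - snd vb i = 0"
        using profile_independent[OF G p _ True, of "\<lambda>i. snd ua i - snd vb i"] by simp
      then show ?thesis by simp
    next
      case False
      then show ?thesis using that by (simp add: R_def)
    qed
    then have snd_eq: "snd ua = snd vb" by blast
    have "fst ua k = fst vb k" for k
    proof (cases "k < n")
      case True
      then have "D * fst ua k = D * fst vb k" using that snd_eq by (simp add: R_def)
      then show ?thesis using D by simp
    next
      case False
      then show ?thesis using that by (simp add: R_def)
    qed
    then show ?thesis using snd_eq by (simp add: prod_eq_iff fun_eq_iff)
  qed
  obtain W where W: "\<And>x. R x (W x)" using R_ex by metis
  define U where "U x = fst (W x)" for x
  define A where "A x = snd (W x)" for x
  have W_lin: "W (\<lambda>k. \<alpha> * x k + \<beta> * y k) = (\<lambda>k. \<alpha> * U x k + \<beta> * U y k, \<lambda>k. \<alpha> * A x k + \<beta> * A y k)"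
    for \<alpha> x \<beta> y
  proof (rule R_unique[OF W])
    have comb: "(\<Sum>i<s. (\<alpha> * A x i + \<beta> * A y i) * d i k) =
        \<alpha> * (\<Sum>i<s. A x i * d i k) + \<beta> * (\<Sum>i<s. A y i * d i k)" for d :: "nat \<Rightarrow> nat \<Rightarrow> int" and k
      by (simp add: distrib_right sum.distrib sum_distrib_left mult.assoc)
    have distr: "D * (\<alpha> * t + \<beta> * t') = \<alpha> * (D * t) + \<beta> * (D * t')" for t t'
      by (simp add: algebra_simps)
    show "R (\<lambda>k. \<alpha> * x k + \<beta> * y k) (\<lambda>k. \<alpha> * U x k + \<beta> * U y k, \<lambda>k. \<alpha> * A x k + \<beta> * A y k)"
      using W[of x] W[of y] unfolding R_def fst_conv snd_conv comb distr
      by (simp add: A_def U_def)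
  qed
  have U_lin: "linear_map U" unfolding linear_map_def using W_lin by (simp add: U_def)
  have A_lin: "A (\<lambda>k. \<alpha> * x k + \<beta> * y k) = (\<lambda>k. \<alpha> * A x k + \<beta> * A y k)" for \<alpha> x \<beta> y
    using W_lin by (simp add: A_def)
  define w0 where "w0 = weight s (gram G0 c0)"
  define w where "w = weight s (gram G c)"
  have norm: "D\<^sup>2 * form H z z = (\<Sum>i<n. \<Sum>j<n. weight s (gram H d) i j * (pair_form a i j)\<^sup>2)"
    if H: "is_lattice n H" and eq: "\<forall>k<n. D * z k = (\<Sum>i<s. a i * d i k)" for H z d a
  proof -
    interpret H: psd_form "form H" by (rule psd_form_lattice[OF H])
    have "D\<^sup>2 * form H z z = form H (\<lambda>k. D * z k) (\<lambda>k. D * z k)"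
      by (simp add: H.scale_left H.scale_right power2_eq_square)
    also have "\<dots> = form H (\<lambda>k. \<Sum>i<s. a i * d i k) (\<lambda>k. \<Sum>i<s. a i * d i k)"
      using eq is_lattice_dim[OF H] by (intro form_cong) auto
    also have "\<dots> = (\<Sum>i<n. \<Sum>j<n. weight s (gram H d) i j * (pair_form a i j)\<^sup>2)"
      by (rule form_combination[OF H s])
    finally show ?thesis .
  qed
  define m where "m v = (w (fst v) (snd v) - w0 (fst v) (snd v)) div (2 * D\<^sup>2)" for v
  have m_eq: "w i j = w0 i j + 2 * D\<^sup>2 * m (i, j)" if "i < n" "j < n" for i j
  proof -
    have "2 * D\<^sup>2 dvd w i j - w0 i j" using cong[OF that, symmetric] unfolding mod_eq_dvd_iff w_def w0_def .
    then show ?thesis by (simp add: m_def)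
  qed
  have m_nonneg: "m v \<ge> 0" if "v \<in> {..<n} \<times> {..<n}" for v
    using le[of "fst v" "snd v"] that D by (auto simp: m_def w_def w0_def pos_imp_zdiv_nonneg_iff)
  define \<phi> where "\<phi> v x = pair_form (A x) (fst v) (snd v)" for v x
  have \<phi>_lin: "\<phi> v (\<lambda>k. \<alpha> * x k + \<beta> * y k) = \<alpha> * \<phi> v x + \<beta> * \<phi> v y" for v \<alpha> x \<beta> y
    by (simp add: \<phi>_def A_lin pair_form_def algebra_simps)
  obtain h where h: "linear_map h" "\<And>x. form (2 \<cdot>\<^sub>m 1\<^sub>m (card (({..<n} \<times> {..<n}) \<times> {..<4::nat}))) (h x) (h x) =
      2 * (\<Sum>v\<in>{..<n} \<times> {..<n}. m v * (\<phi> v x)\<^sup>2)"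
    using four_squares_embedding[of "{..<n} \<times> {..<n}" m \<phi>] m_nonneg \<phi>_lin by auto
  show ?thesis
  proof (rule represents_orth_sumI[OF G0 is_lattice_scaled_identity G U_lin h(1)])
    fix x
    have "D\<^sup>2 * form G x x = (\<Sum>i<n. \<Sum>j<n. w i j * (pair_form (A x) i j)\<^sup>2)"
      unfolding w_def using W[of x] by (intro norm[OF G]) (simp add: R_def A_def)
    also have "\<dots> = (\<Sum>i<n. \<Sum>j<n. w0 i j * (pair_form (A x) i j)\<^sup>2 + D\<^sup>2 * (2 * (m (i, j) * (\<phi> (i, j) x)\<^sup>2)))"
      by (intro sum.cong refl) (simp add: m_eq \<phi>_def algebra_simps)
    also have "\<dots> = (\<Sum>i<n. \<Sum>j<n. w0 i j * (pair_form (A x) i j)\<^sup>2) +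
        D\<^sup>2 * (2 * (\<Sum>i<n. \<Sum>j<n. m (i, j) * (\<phi> (i, j) x)\<^sup>2))"
      by (simp add: sum.distrib sum_distrib_left)
    also have "(\<Sum>i<n. \<Sum>j<n. w0 i j * (pair_form (A x) i j)\<^sup>2) = D\<^sup>2 * form G0 (U x) (U x)"
      unfolding w0_def using W[of x] by (intro norm[OF G0, symmetric]) (simp add: R_def A_def U_def)
    also have "2 * (\<Sum>i<n. \<Sum>j<n. m (i, j) * (\<phi> (i, j) x)\<^sup>2) =
        form (2 \<cdot>\<^sub>m 1\<^sub>m (card (({..<n} \<times> {..<n}) \<times> {..<4::nat}))) (h x) (h x)"
      unfolding h(2) sum.cartesian_product by (simp add: case_prod_unfold)
    finally have "D\<^sup>2 * form G x x = D\<^sup>2 * (form G0 (U x) (U x) +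
        form (2 \<cdot>\<^sub>m 1\<^sub>m (card (({..<n} \<times> {..<n}) \<times> {..<4::nat}))) (h x) (h x))"
      by (simp add: distrib_left)
    then show "form G x x = form G0 (U x) (U x) +
        form (2 \<cdot>\<^sub>m 1\<^sub>m (card (({..<n} \<times> {..<n}) \<times> {..<4::nat}))) (h x) (h x)"
      using D by simp
  qed simp
qed

lemma finite_residues:
  "finite {a :: nat \<Rightarrow> int. (\<forall>i<n. a i \<in> {0..<D}) \<and> (\<forall>i\<ge>n. a i = 0)}"
proof -
  have "finite {f :: nat \<Rightarrow> int. \<forall>i. (i \<in> {..<n} \<longrightarrow> f i \<in> {0..<D}) \<and> (i \<notin> {..<n} \<longrightarrow> f i = 0)}"
    by (rule finite_set_of_finite_funs) auto
  then show ?thesis by (rule rev_finite_subset) auto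
qed

text \<open>Dickson's lemma for the weights. The lattices are sorted into finitely many classes by
the number of vectors in their profile, the residues of their coordinates, and the weights modulo
\<open>2 D\<^sup>2\<close>; within a class, comparable weights differ by multiples of \<open>2 D\<^sup>2\<close>.\<close>

lemma finite_basis_of_lattices:
  assumes n: "n > 0" and S: "\<forall>G\<in>S. is_lattice n G"
  shows "\<exists>F\<subseteq>S. finite F \<and> (\<forall>G\<in>S. \<exists>G0\<in>F.
    represents (orth_sum G0 (2 \<cdot>\<^sub>m 1\<^sub>m (card (({..<n} \<times> {..<n}) \<times> {..<4::nat})))) G)"
proof -
  obtain D where D: "D > 0" and "\<forall>G. is_lattice n G \<longrightarrow> (\<exists>s c. profile n D G s c)"
    using exists_profile[OF n] by blast
  then obtain s c where p: "\<And>G. is_lattice n G \<Longrightarrow> profile n D G (s G) (c G)" by metis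
  define w where "w G = weight (s G) (gram G (c G))" for G
  define \<kappa> where "\<kappa> G v = nat (w G (fst v) (snd v))" for G and v :: "nat \<times> nat"
  define \<rho> where "\<rho> G v = (if v \<in> {..<n} \<times> {..<n} then w G (fst v) (snd v) mod (2 * D\<^sup>2) else 0)" for G v
  define \<gamma> where "\<gamma> G = (s G, residues n D (s G) (c G), \<rho> G)" for G
  have "finite (\<gamma> ` S)"
  proof (rule finite_subset)
    let ?R = "{a :: nat \<Rightarrow> int. (\<forall>i<n. a i \<in> {0..<D}) \<and> (\<forall>i\<ge>n. a i = 0)}"
    let ?W = "{f :: nat \<times> nat \<Rightarrow> int. \<forall>v. (v \<in> {..<n} \<times> {..<n} \<longrightarrow> f v \<in> {0..<2 * D\<^sup>2}) \<and>
        (v \<notin> {..<n} \<times> {..<n} \<longrightarrow> f v = 0)}"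
    have "\<rho> G \<in> ?W" for G using D by (simp add: \<rho>_def)
    moreover have "s G \<in> {..n}" "residues n D (s G) (c G) \<in> Pow ?R" if "G \<in> S" for G
    proof -
      show "s G \<in> {..n}" using p S that by (simp add: profile_def)
      then show "residues n D (s G) (c G) \<in> Pow ?R" by (auto simp: residues_def coordinates_def)
    qed
    ultimately show "\<gamma> ` S \<subseteq> {..n} \<times> Pow ?R \<times> ?W" unfolding \<gamma>_def by blast
    have "finite ?W" by (rule finite_set_of_finite_funs) auto
    then show "finite ({..n} \<times> Pow ?R \<times> ?W)" using finite_residues by blast
  qed
  then obtain F where F: "F \<subseteq> S" "finite F"
    "\<And>G. G \<in> S \<Longrightarrow> \<exists>G0\<in>F. \<gamma> G0 = \<gamma> G \<and> (\<forall>v\<in>{..<n} \<times> {..<n}. \<kappa> G0 v \<le> \<kappa> G v)"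
    using dickson_classes[of "{..<n} \<times> {..<n}" \<gamma> S \<kappa>] by auto
  have "\<exists>G0\<in>F. represents (orth_sum G0 (2 \<cdot>\<^sub>m 1\<^sub>m (card (({..<n} \<times> {..<n}) \<times> {..<4::nat})))) G"
    if GS: "G \<in> S" for G
  proof -
    obtain G0 where G0: "G0 \<in> F" "\<gamma> G0 = \<gamma> G" "\<forall>v\<in>{..<n} \<times> {..<n}. \<kappa> G0 v \<le> \<kappa> G v"
      using F(3)[OF GS] by blast
    have lat: "is_lattice n G0" "is_lattice n G" using G0(1) F(1) S GS by auto
    have eq: "s G0 = s G" "residues n D (s G0) (c G0) = residues n D (s G) (c G)" "\<rho> G0 = \<rho> G"
      using G0(2) unfolding \<gamma>_def prod.inject by blast+
    have "represents (orth_sum G0 (2 \<cdot>\<^sub>m 1\<^sub>m (card (({..<n} \<times> {..<n}) \<times> {..<4::nat})))) G"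
    proof (rule represents_of_dominated_weights[OF D lat])
      show "profile n D G0 (s G) (c G0)" using p[OF lat(1)] eq(1) by simp
      show "profile n D G (s G) (c G)" using p[OF lat(2)] .
      show "residues n D (s G) (c G0) = residues n D (s G) (c G)" using eq(2) unfolding eq(1) .
      fix i j assume ij: "i < n" "j < n"
      have "nat (w G0 i j) \<le> nat (w G i j)" using G0(3) ij by (auto simp: \<kappa>_def)
      then have "w G0 i j \<le> w G i j"
        using profile_weights(1)[OF lat(2) p[OF lat(2)], of i j] by (simp add: w_def nat_le_iff)
      then show "weight (s G) (gram G0 (c G0)) i j \<le> weight (s G) (gram G (c G)) i j"
        using eq(1) by (simp add: w_def)
      show "weight (s G) (gram G0 (c G0)) i j mod (2 * D\<^sup>2) = weight (s G) (gram G (c G)) i j mod (2 * D\<^sup>2)"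
        using fun_cong[OF eq(3), of "(i, j)"] ij eq(1) by (simp add: \<rho>_def w_def)
    qed
    then show ?thesis using G0(1) by blast
  qed
  then show ?thesis using F(1,2) by blast
qed

text \<open>The basis lattices belong to the family, so they have no vector of norm \<open>1\<close> either. This is why Dickson's lemma is
applied to the family itself: subtracting squares without control could leave a remainder with
vectors of norm \<open>1\<close>.\<close>

lemma norm1_free_universal:
  assumes n: "n > 0"
  shows "\<exists>m M. is_lattice m M \<and> norm1_free M \<and> (\<forall>G. is_lattice n G \<and> norm1_free G \<longrightarrow> represents M G)"
proof -
  define N where "N = card (({..<n} \<times> {..<n}) \<times> {..<4::nat})"
  obtain F where F: "F \<subseteq> {G. is_lattice n G \<and> norm1_free G}" "finite F"
    "\<And>G. is_lattice n G \<Longrightarrow> norm1_free G \<Longrightarrow> \<exists>G0\<in>F. represents (orth_sum G0 (2 \<cdot>\<^sub>m 1\<^sub>m N)) G"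
    using finite_basis_of_lattices[OF n, of "{G. is_lattice n G \<and> norm1_free G}"]
    unfolding N_def by auto
  obtain m M where M: "is_lattice m M" "norm1_free M" "\<forall>l\<in>F. represents M l"
    using norm1_free_universal_for_finite[OF F(2), of n] F(1) by auto
  have I: "is_lattice N (2 \<cdot>\<^sub>m 1\<^sub>m N)" by (rule is_lattice_scaled_identity) simp
  have "represents (orth_sum M (2 \<cdot>\<^sub>m 1\<^sub>m N)) G" if G: "is_lattice n G" "norm1_free G" for G
  proof -
    obtain G0 where G0: "G0 \<in> F" "represents (orth_sum G0 (2 \<cdot>\<^sub>m 1\<^sub>m N)) G"
      using F(3)[OF G] by blast
    have L0: "is_lattice n G0" using G0(1) F(1) by auto
    obtain f where f: "linear_map f" "\<And>x y. form (orth_sum G0 (2 \<cdot>\<^sub>m 1\<^sub>m N)) (f x) (f y) = form G x y"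
      using representsE[OF is_lattice_orth_sum[OF L0 I] G(1) G0(2)] by blast
    have "represents M G0" using M(3) G0(1) by blast
    then obtain g where g: "linear_map g" "\<And>x y. form M (g x) (g y) = form G0 x y"
      using representsE[OF M(1) L0] by blast
    show ?thesis
    proof (rule represents_orth_sumI[OF M(1) I G(1)])
      show "linear_map (\<lambda>x. g (f x))" using f(1) g(1) by (simp add: linear_map_def)
      show "linear_map (\<lambda>x k. f x (n + k))" using f(1) by (simp add: linear_map_def)
      show "form G x x = form M (g (f x)) (g (f x)) +
          form (2 \<cdot>\<^sub>m 1\<^sub>m N) (\<lambda>k. f x (n + k)) (\<lambda>k. f x (n + k))" for x
        unfolding f(2)[of x x, symmetric] g(2)
        by (rule form_orth_sum[OF is_lattice_carrier[OF L0] is_lattice_carrier[OF I]])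
    qed
  qed
  then show ?thesis
    using is_lattice_orth_sum[OF M(1) I] norm1_free_orth_sum[OF M(1,2) I norm1_free_double_identity] by blast
qed

section \<open>Orthonormal systems\<close>

context psd_form
begin

definition orthonormal :: "nat \<Rightarrow> (nat \<Rightarrow> nat \<Rightarrow> int) \<Rightarrow> bool" where
  "orthonormal r e \<longleftrightarrow> (\<forall>i<r. \<forall>j<r. B (e i) (e j) = (if i = j then 1 else 0))"

definition orthogonal_component :: "nat \<Rightarrow> (nat \<Rightarrow> nat \<Rightarrow> int) \<Rightarrow> (nat \<Rightarrow> int) \<Rightarrow> nat \<Rightarrow> int" where
  "orthogonal_component r e x = (\<lambda>k. x k - (\<Sum>i<r. B x (e i) * e i k))"

lemma null_vector_orthogonal: "B x x = 0 \<Longrightarrow> B x y = 0"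
  using cauchy_schwarz[of x y] by simp

lemma orthogonal_component_orthogonal:
  assumes "orthonormal r e" "j < r"
  shows "B (orthogonal_component r e x) (e j) = 0"
proof -
  have "(\<Sum>i<r. B x (e i) * B (e i) (e j)) = (\<Sum>i<r. if i = j then B x (e i) else 0)"
    using assms by (intro sum.cong) (auto simp: orthonormal_def)
  also have "\<dots> = B x (e j)" using assms(2) by simp
  finally show ?thesis unfolding orthogonal_component_def diff_left sum_left by simp
qed

lemma inner_orthogonal_component:
  "B (orthogonal_component r e x) y = B x y - (\<Sum>i<r. B x (e i) * B y (e i))"
  unfolding orthogonal_component_def diff_left sum_left using symmetric[of y] by simp

lemma norm_orthogonal_component:
  assumes "orthonormal r e"
  shows "B x x = B (orthogonal_component r e x) (orthogonal_component r e x) + (\<Sum>i<r. (B x (e i))\<^sup>2)"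
proof -
  have "B (orthogonal_component r e x) (orthogonal_component r e x) = B (orthogonal_component r e x) x"
  proof -
    have "B (orthogonal_component r e x) (orthogonal_component r e x) =
        B (orthogonal_component r e x) x - (\<Sum>i<r. B x (e i) * B (orthogonal_component r e x) (e i))"
      unfolding orthogonal_component_def[of r e x, THEN arg_cong, of "B (orthogonal_component r e x)"] diff_right sum_right ..
    then show ?thesis using orthogonal_component_orthogonal[OF assms] by simp
  qed
  then show ?thesis by (simp add: inner_orthogonal_component power2_eq_square)
qed

lemma orthonormal_relation_trivial:
  assumes "orthonormal r e" and "j < r"
    and zero: "B (\<lambda>k. \<Sum>i<r. a i * e i k) (e j) = 0"
  shows "a j = 0"
proof -
  have "(\<Sum>i<r. a i * B (e i) (e j)) = (\<Sum>i<r. if i = j then a i else 0)"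
    using assms(1,2) by (intro sum.cong) (auto simp: orthonormal_def)
  then show ?thesis using zero assms(2) by (simp add: sum_left)
qed

lemma not_orthonormal_above_rank:
  assumes "rank_le r"
  shows "\<not> orthonormal (Suc r) e"
proof
  assume e: "orthonormal (Suc r) e"
  obtain a where a: "\<exists>i<Suc r. a i \<noteq> 0"
    "B (\<lambda>k. \<Sum>i<Suc r. a i * e i k) (\<lambda>k. \<Sum>i<Suc r. a i * e i k) = 0"
    using assms unfolding rank_le_def by blast
  show False
    using a(1) orthonormal_relation_trivial[OF e _ null_vector_orthogonal[OF a(2)]] by blast
qed

text \<open>In a nontrivial relation between the \<open>e\<^sub>i\<close> and \<open>z\<close>, pairing with \<open>e\<^sub>j\<close> shows that only the coefficient of \<open>z\<close>
can be nonzero.\<close>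

lemma complete_orthonormal:
  assumes rank: "rank_le r" and e: "orthonormal r e"
    and orth: "\<And>i. i < r \<Longrightarrow> B z (e i) = 0"
  shows "B z z = 0"
proof -
  define v where "v i = (if i < r then e i else z)" for i
  obtain a where a: "\<exists>i<Suc r. a i \<noteq> 0"
    "B (\<lambda>k. \<Sum>i<Suc r. a i * v i k) (\<lambda>k. \<Sum>i<Suc r. a i * v i k) = 0"
    using rank unfolding rank_le_def by blast
  have v_sum: "(\<Sum>i<r. a i * B (v i) y) = (\<Sum>i<r. a i * B (e i) y)" for y
    by (intro sum.cong) (auto simp: v_def)
  have rel: "(\<Sum>i<r. a i * B (e i) y) + a r * B z y = 0" for y
    using null_vector_orthogonal[OF a(2), of y] unfolding sum_left by (simp add: v_sum) (simp add: v_def)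
  have "a j = 0" if "j < r" for j
  proof (rule orthonormal_relation_trivial[OF e that])
    show "B (\<lambda>k. \<Sum>i<r. a i * e i k) (e j) = 0"
      unfolding sum_left using rel[of "e j"] orth[OF that] by simp
  qed
  then have "a r \<noteq> 0" "\<And>i. i < r \<Longrightarrow> a i = 0" using a(1) by (auto simp: less_Suc_eq)
  then show ?thesis using rel[of z] by simp
qed

lemma parseval:
  assumes "rank_le r" and "orthonormal r e"
  shows "B x y = (\<Sum>i<r. B x (e i) * B y (e i))"
proof -
  have "B (orthogonal_component r e x) (orthogonal_component r e x) = 0"
    using complete_orthonormal[OF assms] orthogonal_component_orthogonal[OF assms(2)] by blast
  then show ?thesis using inner_orthogonal_component[of r e x y] null_vector_orthogonal by simp
qed

end

lemma form_identity: "form (1\<^sub>m m) x y = (\<Sum>i<m. x i * y i)"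
proof -
  have "1 \<cdot>\<^sub>m 1\<^sub>m m = (1\<^sub>m m :: int mat)" by (rule eq_matI) auto
  then show ?thesis using form_scaled_identity[of 1 m x y] by simp
qed

lemma is_lattice_identity: "is_lattice m (1\<^sub>m m)"
proof -
  have "1 \<cdot>\<^sub>m 1\<^sub>m m = (1\<^sub>m m :: int mat)" by (rule eq_matI) auto
  then show ?thesis using is_lattice_scaled_identity[of 1 m] by simp
qed

text \<open>The isometry takes \<open>v\<close> to its coordinates \<open>B(v, e\<^sub>i)\<close>; by Parseval's identity it preserves the form.\<close>

lemma isometric_identity_of_orthonormal:
  assumes l: "is_lattice n l" and e: "psd_form.orthonormal (form l) n e"
  shows "isometric_lattices l (1\<^sub>m n)"
proof -
  interpret psd_form "form l" by (rule psd_form_lattice[OF l])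
  note rank = rank_le_lattice[OF l]
  note dim = is_lattice_dim[OF l]
  define F where "F v = vec n (\<lambda>i. form l (\<lambda>k. v $ k) (e i))" for v :: "int vec"
  have add: "form l (\<lambda>k. (x + y) $ k) z = form l (\<lambda>k. x $ k) z + form l (\<lambda>k. y $ k) z"
    if "x \<in> carrier_vec n" "y \<in> carrier_vec n" for x y z
  proof -
    have "form l (\<lambda>k. (x + y) $ k) z = form l (\<lambda>k. 1 * x $ k + 1 * y $ k) z"
      using that dim by (intro form_cong) auto
    then show ?thesis unfolding linear by simp
  qed
  have smult: "form l (\<lambda>k. (a \<cdot>\<^sub>v x) $ k) z = a * form l (\<lambda>k. x $ k) z"
    if "x \<in> carrier_vec n" for a x z
  proof -
    have "form l (\<lambda>k. (a \<cdot>\<^sub>v x) $ k) z = form l (\<lambda>k. a * x $ k) z"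
      using that dim by (intro form_cong) auto
    then show ?thesis unfolding scale_left .
  qed
  have "Z_linear n n F"
    unfolding Z_linear_def F_def by (auto simp: add smult)
  moreover have "bilin (1\<^sub>m n) (F x) (F y) = bilin l x y"
    if "x \<in> carrier_vec n" "y \<in> carrier_vec n" for x y
  proof -
    have "bilin (1\<^sub>m n) (F x) (F y) = form (1\<^sub>m n) (\<lambda>i. F x $ i) (\<lambda>i. F y $ i)"
      by (rule bilin_eq_form) (auto simp: F_def)
    also have "\<dots> = (\<Sum>i<n. form l (\<lambda>k. x $ k) (e i) * form l (\<lambda>k. y $ k) (e i))"
      by (simp add: form_identity F_def)
    also have "\<dots> = form l (\<lambda>k. x $ k) (\<lambda>k. y $ k)"
      by (rule parseval[OF rank e, symmetric])
    also have "\<dots> = bilin l x y" using bilin_eq_form[OF is_lattice_carrier[OF l] that] by simp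
    finally show ?thesis .
  qed
  moreover have "bij_betw F (carrier_vec n) (carrier_vec n)"
  proof (rule bij_betw_imageI)
    show "inj_on F (carrier_vec n)"
    proof (rule inj_onI)
      fix x y :: "int vec" assume x: "x \<in> carrier_vec n" and y: "y \<in> carrier_vec n" and eq: "F x = F y"
      have "form l (\<lambda>k. x $ k - y $ k) (e i) = 0" if "i < n" for i
        using arg_cong[OF eq, of "\<lambda>v. v $ i"] that unfolding diff_left by (simp add: F_def)
      then have "form l (\<lambda>k. x $ k - y $ k) (\<lambda>k. x $ k - y $ k) = 0"
        by (rule complete_orthonormal[OF rank e])
      then show "x = y" unfolding form_eq_0_iff[OF l] using x y by (intro eq_vecI) auto
    qed
    show "F ` carrier_vec n = carrier_vec n"
    proof
      show "F ` carrier_vec n \<subseteq> carrier_vec n" by (auto simp: F_def)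
      show "carrier_vec n \<subseteq> F ` carrier_vec n"
      proof
        fix w :: "int vec" assume w: "w \<in> carrier_vec n"
        define v where "v = vec n (\<lambda>k. \<Sum>i<n. w $ i * e i k)"
        have "form l (\<lambda>k. v $ k) (e j) = w $ j" if j: "j < n" for j
        proof -
          have "form l (\<lambda>k. v $ k) (e j) = form l (\<lambda>k. \<Sum>i<n. w $ i * e i k) (e j)"
            using dim by (intro form_cong) (auto simp: v_def)
          also have "\<dots> = (\<Sum>i<n. if i = j then w $ i else 0)"
            unfolding sum_left using e j by (intro sum.cong) (auto simp: orthonormal_def)
          finally show ?thesis using j by simp
        qed
        then have "F v = w" using w by (intro eq_vecI) (auto simp: F_def)
        moreover have "v \<in> carrier_vec n" by (simp add: v_def)
        ultimately show "w \<in> F ` carrier_vec n" by blast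
      qed
    qed
  qed
  ultimately show ?thesis
    unfolding isometric_lattices_def preserves_form_def dim by auto
qed

section \<open>Splitting off vectors of norm one\<close>

text \<open>The Gram matrix of \<open>B(x,y) + \<Sum> B(x,e\<^sub>t) B(y,e\<^sub>t)\<close>: the form is unchanged on the orthogonal complement of
the \<open>e\<^sub>t\<close>, and doubled on their span.\<close>

definition double_units :: "int mat \<Rightarrow> nat \<Rightarrow> (nat \<Rightarrow> nat \<Rightarrow> int) \<Rightarrow> int mat" where
  "double_units l k e = mat (dim_row l) (dim_row l) (\<lambda>(i, j). l $$ (i, j) +
     (\<Sum>t<k. (\<Sum>p<dim_row l. l $$ (i, p) * e t p) * (\<Sum>p<dim_row l. l $$ (j, p) * e t p)))"

lemma form_double_units:
  "form (double_units l k e) x y = form l x y + (\<Sum>t<k. form l x (e t) * form l y (e t))"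
proof -
  let ?n = "dim_row l"
  define w where "w t i = (\<Sum>p<?n. l $$ (i, p) * e t p)" for t i
  have fw: "form l z (e t) = (\<Sum>i<?n. z i * w t i)" for z t
    by (simp add: form_def w_def sum_distrib_left mult.assoc)
  have entry: "double_units l k e $$ (i, j) = l $$ (i, j) + (\<Sum>t<k. w t i * w t j)"
    if "i < ?n" "j < ?n" for i j
    using that by (simp add: double_units_def w_def)
  have dim: "dim_row (double_units l k e) = ?n" by (simp add: double_units_def)
  have "form (double_units l k e) x y = (\<Sum>i<?n. \<Sum>j<?n. x i * l $$ (i, j) * y j +
      (\<Sum>t<k. (x i * w t i) * (y j * w t j)))"
    unfolding form_def dim
    by (intro sum.cong refl) (simp add: entry algebra_simps sum_distrib_left)
  also have "\<dots> = form l x y + (\<Sum>i<?n. \<Sum>j<?n. \<Sum>t<k. (x i * w t i) * (y j * w t j))"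
    by (simp add: form_def sum.distrib)
  also have "(\<Sum>i<?n. \<Sum>j<?n. \<Sum>t<k. (x i * w t i) * (y j * w t j)) =
      (\<Sum>i<?n. \<Sum>t<k. \<Sum>j<?n. (x i * w t i) * (y j * w t j))"
    by (intro sum.cong refl sum.swap)
  also have "\<dots> = (\<Sum>t<k. \<Sum>i<?n. \<Sum>j<?n. (x i * w t i) * (y j * w t j))" by (rule sum.swap)
  also have "\<dots> = (\<Sum>t<k. form l x (e t) * form l y (e t))"
    by (simp add: fw sum_product)
  finally show ?thesis .
qed

lemma is_lattice_double_units:
  assumes l: "is_lattice n l"
  shows "is_lattice n (double_units l k e)"
  unfolding is_lattice_iff form_double_units
proof (intro conjI allI impI)
  interpret psd_form "form l" by (rule psd_form_lattice[OF l])
  show "double_units l k e \<in> carrier_mat n n" using is_lattice_dim[OF l] by (simp add: double_units_def)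
  show "form l x y + (\<Sum>t<k. form l x (e t) * form l y (e t)) =
      form l y x + (\<Sum>t<k. form l y (e t) * form l x (e t))" for x y
    by (simp add: symmetric[of x y] mult.commute)
  fix x :: "nat \<Rightarrow> int" assume "\<exists>i<n. x i \<noteq> 0"
  then have "form l x x > 0" using l by (simp add: is_lattice_iff)
  moreover have "(\<Sum>t<k. form l x (e t) * form l x (e t)) \<ge> 0" by (intro sum_nonneg) simp
  ultimately show "0 < form l x x + (\<Sum>t<k. form l x (e t) * form l x (e t))" by linarith
qed

text \<open>A vector of norm \<open>1\<close> would have norm \<open>1\<close> in \<open>l\<close> and be orthogonal to all \<open>e\<^sub>t\<close>, so it would enlarge the
orthonormal system.\<close>

lemma norm1_free_double_units:
  assumes l: "is_lattice n l" and e: "psd_form.orthonormal (form l) k e"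
    and maximal: "\<And>e'. \<not> psd_form.orthonormal (form l) (Suc k) e'"
  shows "norm1_free (double_units l k e)"
  unfolding norm1_free_def
proof (intro allI notI)
  interpret psd_form "form l" by (rule psd_form_lattice[OF l])
  fix x assume "form (double_units l k e) x x = 1"
  then have one: "form l x x + (\<Sum>t<k. form l x (e t) * form l x (e t)) = 1"
    by (simp add: form_double_units)
  have "form l x x \<noteq> 0"
  proof
    assume "form l x x = 0"
    then show False using one null_vector_orthogonal[of x] by simp
  qed
  moreover have sum_nn: "(\<Sum>t<k. form l x (e t) * form l x (e t)) \<ge> 0" by (intro sum_nonneg) simp
  ultimately have x1: "form l x x = 1" and "(\<Sum>t<k. form l x (e t) * form l x (e t)) = 0"
    using one nonneg[of x] by linarith+
  then have x0: "form l x (e t) = 0" if "t < k" for t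
    using that by (simp add: sum_nonneg_eq_0_iff)
  have x0': "form l (e t) x = 0" if "t < k" for t
    using x0[OF that] symmetric[of "e t" x] by simp
  have "orthonormal (Suc k) (\<lambda>i. if i < k then e i else x)"
    using e x1 x0 x0' unfolding orthonormal_def by (auto simp: less_Suc_eq)
  then show False using maximal by blast
qed

text \<open>Take an orthonormal system of maximal length \<open>k < n\<close>. Its coordinates fit into \<open>I\<close> of rank \<open>n - 1\<close>, and the
orthogonal component of \<open>x\<close> has the same norm in \<open>l\<close> as in the lattice with doubled units,
which \<open>M\<close> represents.\<close>

lemma represents_without_orthonormal_basis:
  assumes n: "n > 0" and l: "is_lattice n l" and M: "is_lattice m M"
    and M_rep: "\<And>G. is_lattice n G \<Longrightarrow> norm1_free G \<Longrightarrow> represents M G"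
    and not_unit: "\<And>e. \<not> psd_form.orthonormal (form l) n e"
  shows "represents (orth_sum (1\<^sub>m (n - 1)) M) l"
proof -
  interpret psd_form "form l" by (rule psd_form_lattice[OF l])
  define P where "P r \<longleftrightarrow> (\<exists>e. orthonormal r e)" for r
  have "P 0" "\<not> P n" using not_unit by (simp_all add: P_def orthonormal_def)
  then obtain k where k: "k < n" "P k" "\<not> P (Suc k)"
    using ex_least_nat_less[of "\<lambda>r. \<not> P r" n] by auto
  then obtain e where e: "orthonormal k e" by (auto simp: P_def)
  have G: "is_lattice n (double_units l k e)" by (rule is_lattice_double_units[OF l])
  have "norm1_free (double_units l k e)"
    using k(3) by (intro norm1_free_double_units[OF l e]) (simp add: P_def)
  then obtain f where f: "linear_map f"
    "\<And>x y. form M (f x) (f y) = form (double_units l k e) x y"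
    using representsE[OF M G M_rep[OF G]] by blast
  have res_lin: "orthogonal_component k e (\<lambda>i. a * x i + b * y i) = (\<lambda>i. a * orthogonal_component k e x i + b * orthogonal_component k e y i)" for a x b y
    unfolding orthogonal_component_def linear
    by (simp add: algebra_simps sum.distrib sum_distrib_left)
  show ?thesis
  proof (rule represents_orth_sumI[OF is_lattice_identity M l])
    show "linear_map (\<lambda>x t. if t < k then form l x (e t) else 0)"
      by (auto simp: linear_map_def linear)
    show "linear_map (\<lambda>x. f (orthogonal_component k e x))"
      using f(1) by (simp add: linear_map_def res_lin)
    fix x
    have "form (1\<^sub>m (n - 1)) (\<lambda>t. if t < k then form l x (e t) else 0) (\<lambda>t. if t < k then form l x (e t) else 0)
        = (\<Sum>t<n - 1. if t < k then (form l x (e t))\<^sup>2 else 0)"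
      unfolding form_identity by (intro sum.cong) (auto simp: power2_eq_square)
    also have "\<dots> = (\<Sum>t<k. (form l x (e t))\<^sup>2)"
      using k(1) by (intro sum.mono_neutral_cong_right) auto
    finally show "form l x x =
        form (1\<^sub>m (n - 1)) (\<lambda>t. if t < k then form l x (e t) else 0) (\<lambda>t. if t < k then form l x (e t) else 0)
        + form M (f (orthogonal_component k e x)) (f (orthogonal_component k e x))"
      unfolding f(2) form_double_units
      using norm_orthogonal_component[OF e, of x] orthogonal_component_orthogonal[OF e] by simp
  qed
qed

text \<open>The images of the unit vectors have norm \<open>1\<close>, so their components in \<open>M\<close> vanish and their components in \<open>I\<close> of
rank \<open>n - 1\<close> are \<open>n\<close> orthonormal vectors.\<close>

lemma not_represents_identity:
  assumes n: "n > 0" and M: "is_lattice m M" "norm1_free M"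
  shows "\<not> represents (orth_sum (1\<^sub>m (n - 1)) M) (1\<^sub>m n)"
proof
  let ?L = "orth_sum (1\<^sub>m (n - 1)) M"
  assume "represents ?L (1\<^sub>m n)"
  then obtain f where f: "\<And>x y. form ?L (f x) (f y) = form (1\<^sub>m n) x y"
    using representsE[OF is_lattice_orth_sum[OF is_lattice_identity M(1)] is_lattice_identity] by blast
  interpret I: psd_form "form (1\<^sub>m (n - 1))" by (rule psd_form_lattice[OF is_lattice_identity])
  interpret M: psd_form "form M" by (rule psd_form_lattice[OF M(1)])
  define v where "v i = f (\<lambda>k. if k = i then 1 else 0)" for i :: nat
  define tail where "tail i = (\<lambda>k. v i (n - 1 + k))" for i
  have v: "form (1\<^sub>m (n - 1)) (v i) (v j) + form M (tail i) (tail j) = (if i = j then 1 else 0)"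
    if "i < n" "j < n" for i j
  proof -
    have "form ?L (v i) (v j) = (\<Sum>k<n. (if k = i then 1 else 0) * (if k = j then 1 else 0))"
      unfolding v_def f form_identity ..
    also have "\<dots> = (\<Sum>k<n. if k = i then (if i = j then 1 else 0) else 0)"
      by (intro sum.cong) auto
    also have "\<dots> = (if i = j then 1 else 0)" using that by simp
    finally show ?thesis
      unfolding form_orth_sum[OF is_lattice_carrier[OF is_lattice_identity] is_lattice_carrier[OF M(1)]]
      by (simp add: tail_def)
  qed
  have "form M (tail i) (tail i) = 0" if "i < n" for i
  proof -
    have "form M (tail i) (tail i) \<noteq> 1" using M(2) by (simp add: norm1_free_def)
    then show ?thesis
      using v[OF that that] I.nonneg[of "v i"] M.nonneg[of "tail i"] by simp
  qed
  then have "form M (tail i) (tail j) = 0" if "i < n" for i j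
    using that M.null_vector_orthogonal by blast
  then have "I.orthonormal n v" using v unfolding I.orthonormal_def by simp
  then have "I.orthonormal (Suc (n - 1)) v" using n by simp
  then show False using I.not_orthonormal_above_rank[OF rank_le_lattice[OF is_lattice_identity]] by blast
qed

section \<open>The identity lattice in criterion sets\<close>

theorem proposition1:
  fixes n :: nat and S :: "int mat set"
  assumes "n > 0"
    and "n_criterion_set n S"
  shows "\<exists>l \<in> S. isometric_lattices l (1\<^sub>m n)"
proof (rule ccontr)
  assume none: "\<not> (\<exists>l \<in> S. isometric_lattices l (1\<^sub>m n))"
  obtain m M where M: "is_lattice m M" "norm1_free M"
    and M_rep: "\<And>G. is_lattice n G \<Longrightarrow> norm1_free G \<Longrightarrow> represents M G"
    using norm1_free_universal[OF assms(1)] by blast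
  let ?L = "orth_sum (1\<^sub>m (n - 1)) M"
  have "represents ?L l" if "l \<in> S" for l
  proof (rule represents_without_orthonormal_basis[OF assms(1) _ M(1) M_rep])
    show l: "is_lattice n l" using assms(2) that by (simp add: n_criterion_set_def)
    show "\<not> psd_form.orthonormal (form l) n e" for e
      using isometric_identity_of_orthonormal[OF l] none that by blast
  qed
  then have "n_universal n ?L"
    using assms(2) is_lattice_orth_sum[OF is_lattice_identity M(1)] unfolding n_criterion_set_def by blast
  then have "represents ?L (1\<^sub>m n)" using is_lattice_identity unfolding n_universal_def by blast
  then show False using not_represents_identity[OF assms(1) M] by blast
qed

end
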